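(* Let $K$ be a field and let $G$ be a finite simple chordal graph on the vertex set $[n]$. Then $G$ is rigid if and only if each edge of $G$ is a branch and each vertex of a $3$-cycle of $G$ belongs to a leaf.
   Context: Let $S=K[x_1,\ldots,x_n]$. The edge ideal $I(G)\subseteq S$ is generated by the products $x_ix_j$ with $\{i,j\}\in E(G)$. For an ideal $I\subseteq S$, $T^1(S/I)$ is the cokernel of $\delta^*:\mathrm{Der}_K(S)\to\mathrm{Hom}_S(I,S/I)$, $\delta^*(\partial)(f)=\partial f+I$. The graph $G$ is called rigid if $T^1(S/I(G))=0$. A graph is chordal if every cycle of length $\ge4$ has a chord. A vertex is free if it has degree $1$. An edge is a leaf if it contains a free vertex. An edge $e$ of $G$ is a branch if there exists a leaf $e'\neq e$ with $e\cap e'\neq\emptyset$. *)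

theory Defs
  imports "HOL-Algebra.Algebraic_Closure_Type" "HOL-Library.Poly_Mapping"
begin

section \<open>Modules of homomorphisms and quotient modules\<close>

text \<open>The record type of modules extends that of rings. The ring components \<open>mult\<close> and \<open>one\<close> have no
  meaning for a module and are left undefined below; \<^locale>\<open>module\<close> does not constrain them.\<close>

definition regular_module :: "('a, 'm) ring_scheme \<Rightarrow> ('a, 'a) module" where
  "regular_module R =
     \<lparr>carrier = carrier R, monoid.mult = undefined, one = undefined, zero = \<zero>\<^bsub>R\<^esub>, add = add R,
      module.smult = monoid.mult R\<rparr>"

definition quotient_module ::
  "('a, 'm) ring_scheme \<Rightarrow> ('a, 'b) module \<Rightarrow> 'b set \<Rightarrow> ('a, 'b set) module" where
  "quotient_module R M N =
     \<lparr>carrier = a_rcosets\<^bsub>M\<^esub> N, monoid.mult = undefined, one = undefined, zero = N, add = set_add M,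
      module.smult = (\<lambda>r C. \<Union>x\<in>C. N +>\<^bsub>M\<^esub> (r \<odot>\<^bsub>M\<^esub> x))\<rparr>"

text \<open>Homomorphisms are extensional functions, so that equality in the module of homomorphisms
  is equality on the carrier of the domain.\<close>

definition module_homs ::
  "('a, 'm) ring_scheme \<Rightarrow> ('a, 'b) module \<Rightarrow> ('a, 'c) module \<Rightarrow> ('b \<Rightarrow> 'c) set" where
  "module_homs R M N =
     {\<phi> \<in> carrier M \<rightarrow>\<^sub>E carrier N.
        (\<forall>x\<in>carrier M. \<forall>y\<in>carrier M. \<phi> (x \<oplus>\<^bsub>M\<^esub> y) = \<phi> x \<oplus>\<^bsub>N\<^esub> \<phi> y) \<and>
        (\<forall>r\<in>carrier R. \<forall>x\<in>carrier M. \<phi> (r \<odot>\<^bsub>M\<^esub> x) = r \<odot>\<^bsub>N\<^esub> \<phi> x)}"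

definition Hom_module ::
  "('a, 'm) ring_scheme \<Rightarrow> ('a, 'b) module \<Rightarrow> ('a, 'c) module \<Rightarrow> ('a, 'b \<Rightarrow> 'c) module" where
  "Hom_module R M N =
     \<lparr>carrier = module_homs R M N, monoid.mult = undefined, one = undefined,
      zero = (\<lambda>x\<in>carrier M. \<zero>\<^bsub>N\<^esub>),
      add = (\<lambda>\<phi> \<psi>. \<lambda>x\<in>carrier M. \<phi> x \<oplus>\<^bsub>N\<^esub> \<psi> x),
      module.smult = (\<lambda>r \<phi>. \<lambda>x\<in>carrier M. r \<odot>\<^bsub>N\<^esub> \<phi> x)\<rparr>"


section \<open>Polynomial rings, derivations and the first cotangent cohomology\<close>

text \<open>The polynomial ring over \<open>'k\<close> in the variables indexed by \<open>'n\<close>: finitely supported functions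
  from exponent vectors to coefficients, with the convolution product.\<close>

type_synonym ('n, 'k) mpoly = "('n \<Rightarrow>\<^sub>0 nat) \<Rightarrow>\<^sub>0 'k"

definition Const :: "'k::zero \<Rightarrow> ('n, 'k) mpoly" where
  "Const c = Poly_Mapping.single 0 c"

definition Var :: "'n \<Rightarrow> ('n, 'k::zero_neq_one) mpoly" where
  "Var i = Poly_Mapping.single (Poly_Mapping.single i 1) 1"

abbreviation mpoly_ring :: "('n, 'k::field) mpoly ring" where
  "mpoly_ring \<equiv> ring_of_type_algebra"

definition Der :: "(('n, 'k::field) mpoly \<Rightarrow> ('n, 'k) mpoly) set" where
  "Der = {\<delta>. (\<forall>f g. \<delta> (f + g) = \<delta> f + \<delta> g) \<and>
             (\<forall>c f. \<delta> (Const c * f) = Const c * \<delta> f) \<and>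
             (\<forall>f g. \<delta> (f * g) = f * \<delta> g + \<delta> f * g)}"

definition Hom_to_quotient ::
  "('n, 'k::field) mpoly set \<Rightarrow> (('n, 'k) mpoly, ('n, 'k) mpoly \<Rightarrow> ('n, 'k) mpoly set) module" where
  "Hom_to_quotient I =
     Hom_module mpoly_ring ((regular_module mpoly_ring)\<lparr>carrier := I\<rparr>)
       (quotient_module mpoly_ring (regular_module mpoly_ring) I)"

definition delta_star ::
  "('n, 'k::field) mpoly set \<Rightarrow> (('n, 'k) mpoly \<Rightarrow> ('n, 'k) mpoly)
     \<Rightarrow> ('n, 'k) mpoly \<Rightarrow> ('n, 'k) mpoly set" where
  "delta_star I \<delta> = (\<lambda>f\<in>I. I +>\<^bsub>mpoly_ring\<^esub> \<delta> f)"

definition T1 ::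
  "('n, 'k::field) mpoly set
     \<Rightarrow> (('n, 'k) mpoly, (('n, 'k) mpoly \<Rightarrow> ('n, 'k) mpoly set) set) module" where
  "T1 I = quotient_module mpoly_ring (Hom_to_quotient I) (delta_star I ` Der)"


section \<open>Graphs\<close>

text \<open>A graph is given by its set of edges; its vertex set is the whole type.\<close>

definition simple_graph :: "'n set set \<Rightarrow> bool" where
  "simple_graph E \<longleftrightarrow> (\<forall>e\<in>E. card e = 2)"

definition edge_ideal :: "'n set set \<Rightarrow> ('n, 'k::field) mpoly set" where
  "edge_ideal E = genideal mpoly_ring {Var i * Var j | i j. {i, j} \<in> E}"

text \<open>Rigidity depends on the field, which is passed as a type argument.\<close>

definition rigid :: "'k::field itself \<Rightarrow> 'n set set \<Rightarrow> bool" where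
  "rigid _ E \<longleftrightarrow>
     carrier (T1 (edge_ideal E :: ('n, 'k) mpoly set)) =
       {\<zero>\<^bsub>T1 (edge_ideal E :: ('n, 'k) mpoly set)\<^esub>}"

text \<open>A cycle is the list of its vertices in cyclic order.\<close>

definition cycle_edges :: "'n list \<Rightarrow> 'n set set" where
  "cycle_edges c = {{c ! i, c ! (Suc i mod length c)} | i. i < length c}"

definition is_cycle :: "'n set set \<Rightarrow> 'n list \<Rightarrow> bool" where
  "is_cycle E c \<longleftrightarrow> length c \<ge> 3 \<and> distinct c \<and> cycle_edges c \<subseteq> E"

definition chordal :: "'n set set \<Rightarrow> bool" where
  "chordal E \<longleftrightarrow>
     (\<forall>c. is_cycle E c \<and> length c \<ge> 4 \<longrightarrow> (\<exists>e\<in>E. e \<subseteq> set c \<and> e \<notin> cycle_edges c))"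

definition vertex_degree :: "'n set set \<Rightarrow> 'n \<Rightarrow> nat" where
  "vertex_degree E v = card {e \<in> E. v \<in> e}"

definition free_vertex :: "'n set set \<Rightarrow> 'n \<Rightarrow> bool" where
  "free_vertex E v \<longleftrightarrow> vertex_degree E v = 1"

definition leaf :: "'n set set \<Rightarrow> 'n set \<Rightarrow> bool" where
  "leaf E e \<longleftrightarrow> e \<in> E \<and> (\<exists>v\<in>e. free_vertex E v)"

definition branch :: "'n set set \<Rightarrow> 'n set \<Rightarrow> bool" where
  "branch E e \<longleftrightarrow> e \<in> E \<and> (\<exists>e'. leaf E e' \<and> e' \<noteq> e \<and> e \<inter> e' \<noteq> {})"

end

theory Submission
  imports Defs
begin

text \<open>
  \<open>S/I(G)\<close> has the monomials divisible by no edge as a basis, so rigidity can be checked on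
  coefficients. If \<open>A\<close> is independent and \<open>a\<close> is the product of the variables in \<open>A\<close>, then
  \<open>f \<mapsto> a f / x\<^sub>i\<close>, restricted to multiples of \<open>x\<^sub>j\<close>, is a homomorphism and not a derivation as
  soon as \<open>i\<close> has at least two neighbours outside \<open>N(A)\<close> and one of them, \<open>j\<close>, is adjacent to all the
  others (here \<open>i\<close> lies neither in \<open>A\<close> nor in \<open>N(A)\<close>), and
  \<open>f \<mapsto> a f / (x\<^sub>i x\<^sub>j)\<close> is one as soon as \<open>N(A)\<close> isolates the edge \<open>ij\<close>. In a chordal graph an
  exchange argument produces independent sets \<open>A\<close> that avoid the neighbourhoods of prescribed
  vertices and cover every neighbour of \<open>i\<close> that can be covered at all; choosing \<open>A\<close> suitably, one
  of the two obstructions occurs whenever the pendant vertices demanded by the criterion are missing.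
  Conversely, pendant vertices provide enough syzygies to read off a derivation from the coefficients
  of a homomorphism.
\<close>

abbreviation lookup where "lookup \<equiv> Poly_Mapping.lookup"
abbreviation single where "single \<equiv> Poly_Mapping.single"


section \<open>Homomorphisms modulo an ideal\<close>

lemma poly_mapping_sum_single:
  fixes f :: "'a \<Rightarrow>\<^sub>0 'b::comm_monoid_add"
  shows "f = (\<Sum>s\<in>Poly_Mapping.keys f. single s (lookup f s))"
  by (rule poly_mapping_eqI)
    (simp add: lookup_sum lookup_single when_def in_keys_iff)

text \<open>Induction over the terms that really occur in \<open>f\<close>: the case
  \<open>single\<close> comes with \<open>lookup f s \<noteq> 0\<close>, so membership of
  \<open>f\<close> in a monomial ideal can be used term by term.\<close>

lemma poly_mapping_add_induct [case_names zero single add]: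
  fixes f :: "'a \<Rightarrow>\<^sub>0 'b::comm_monoid_add"
  assumes "P 0" and "\<And>s. lookup f s \<noteq> 0 \<Longrightarrow> P (single s (lookup f s))"
    and "\<And>g h. P g \<Longrightarrow> P h \<Longrightarrow> P (g + h)"
  shows "P f"
proof -
  have "P (\<Sum>s\<in>T. single s (lookup f s))"
    if "finite T" "T \<subseteq> Poly_Mapping.keys f" for T
    using that by induction (auto intro: assms simp: in_keys_iff)
  from this[of "Poly_Mapping.keys f"] show ?thesis
    using poly_mapping_sum_single[of f] by simp
qed

lemma mpoly_ring_simps [simp]:
  "carrier mpoly_ring = UNIV" "monoid.mult mpoly_ring = (*)" "one mpoly_ring = 1"
  "zero mpoly_ring = 0" "add mpoly_ring = (+)"
  by (auto simp: ring_of_type_algebra_def)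

lemma ring_mpoly_ring: "ring (mpoly_ring :: ('n, 'k::field) mpoly ring)"
  by (rule ring_from_type_algebra)

text \<open>Linearity of the map \<open>f \<mapsto> F f + I\<close> on \<open>I\<close>, expressed
  through representatives so that later arguments deal with polynomials instead of cosets.\<close>

definition hom_mod :: "('n, 'k::field) mpoly set \<Rightarrow> (('n, 'k) mpoly \<Rightarrow> ('n, 'k) mpoly) \<Rightarrow> bool" where
  "hom_mod I F \<longleftrightarrow> (\<forall>f\<in>I. \<forall>g\<in>I. F (f + g) - (F f + F g) \<in> I) \<and>
     (\<forall>r. \<forall>f\<in>I. F (r * f) - r * F f \<in> I)"

section \<open>Cosets, homomorphisms into \<open>S/I\<close>, and the vanishing of
  \<open>T1\<close>\<close>

locale mpoly_ideal =
  fixes I :: "('n, 'k::field) mpoly set"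
  assumes zero_mem: "0 \<in> I"
    and add_mem: "f \<in> I \<Longrightarrow> g \<in> I \<Longrightarrow> f + g \<in> I"
    and mult_mem: "f \<in> I \<Longrightarrow> r * f \<in> I"
begin

lemma mult_mem_right: "f \<in> I \<Longrightarrow> f * r \<in> I"
  using mult_mem[of f r] by (simp add: mult.commute)

lemma uminus_mem: "f \<in> I \<Longrightarrow> - f \<in> I"
  using mult_mem[of f "- 1"] by simp

lemma diff_mem: "f \<in> I \<Longrightarrow> g \<in> I \<Longrightarrow> f - g \<in> I"
  using add_mem[of f "- g"] uminus_mem[of g] by simp

lemma diff_trans: "f - g \<in> I \<Longrightarrow> g - h \<in> I \<Longrightarrow> f - h \<in> I"
  using add_mem[of "f - g" "g - h"] by simp

lemma diff_sym: "f - g \<in> I \<Longrightarrow> g - f \<in> I"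
  using uminus_mem[of "f - g"] by simp

definition coset :: "('n, 'k) mpoly \<Rightarrow> ('n, 'k) mpoly set" where
  "coset f = {h. h - f \<in> I}"

lemma coset_eq_iff: "coset f = coset g \<longleftrightarrow> f - g \<in> I"
proof
  assume "coset f = coset g"
  moreover have "f \<in> coset f" by (simp add: coset_def zero_mem)
  ultimately show "f - g \<in> I" by (auto simp: coset_def)
qed (auto simp: coset_def dest: diff_trans diff_sym)

lemma mem_coset_self: "f \<in> coset f"
  by (simp add: coset_def zero_mem)

lemma a_r_coset_eq: 
  assumes "add M = (+)"
  shows "I +>\<^bsub>M\<^esub> f = coset f"
proof -
  have "h \<in> (\<Union>x\<in>I. {x + f})" if "h - f \<in> I" for h
    using that by (intro UN_I[of "h - f"]) auto
  then show ?thesis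
    using assms by (auto simp: a_r_coset_def' coset_def)
qed

lemma add_regular_module: "add (regular_module mpoly_ring) = (+)"
  by (simp add: regular_module_def)

lemma carrier_regular_module: "carrier (regular_module mpoly_ring) = UNIV"
  by (simp add: regular_module_def)

lemma smult_regular_module: "module.smult (regular_module mpoly_ring) = (*)"
  by (simp add: regular_module_def)

lemma set_add_coset:
  "set_add (regular_module mpoly_ring) (coset f) (coset g) = coset (f + g)"
proof -
  have "\<exists>x. x - f \<in> I \<and> (\<exists>y. y - g \<in> I \<and> h = x + y)" if "h - (f + g) \<in> I" for h
    using that zero_mem by (intro exI[of _ "h - g"] conjI exI[of _ g]) (auto simp: algebra_simps)
  then show ?thesis
    using add_mem by (fastforce simp: set_add_def' add_regular_module coset_def algebra_simps)
qed

lemma smult_coset: "(\<Union>z\<in>coset f. coset (r * z)) = coset (r * f)"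
proof -
  have "coset (r * z) = coset (r * f)" if "z \<in> coset f" for z
    using that mult_mem[of "z - f" r] by (simp add: coset_eq_iff) (simp add: coset_def algebra_simps)
  then show ?thesis using mem_coset_self by blast
qed

definition hom_of :: "(('n, 'k) mpoly \<Rightarrow> ('n, 'k) mpoly) \<Rightarrow> ('n, 'k) mpoly \<Rightarrow> ('n, 'k) mpoly set" where
  "hom_of F = (\<lambda>f\<in>I. coset (F f))"

lemma hom_of_eq_iff: "hom_of F = hom_of G \<longleftrightarrow> (\<forall>f\<in>I. F f - G f \<in> I)"
  by (simp add: hom_of_def fun_eq_iff restrict_def coset_eq_iff) blast

lemma delta_star_eq: "delta_star I \<delta> = hom_of \<delta>"
  by (simp add: delta_star_def hom_of_def a_r_coset_eq)

text \<open>Choosing a representative of every value turns a homomorphism into a map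
  \<open>F\<close>; linearity of the homomorphism is then exactly
  \<open>hom_mod I F\<close>.\<close>

lemma carrier_Hom: "carrier (Hom_to_quotient I) = hom_of ` Collect (hom_mod I)"
proof
  let ?Q = "quotient_module mpoly_ring (regular_module mpoly_ring) I"
  have Q: "carrier ?Q = Set.range coset" "add ?Q = set_add (regular_module mpoly_ring)"
    "module.smult ?Q r C = (\<Union>x\<in>C. coset (r * x))" for r C
  proof -
    have *: "I +>\<^bsub>regular_module mpoly_ring\<^esub> f = coset f" for f
      by (rule a_r_coset_eq[OF add_regular_module])
    show "carrier ?Q = Set.range coset" "add ?Q = set_add (regular_module mpoly_ring)"
      unfolding quotient_module_def A_RCOSETS_def'
      by (simp_all only: partial_object.simps ring.simps carrier_regular_module * UNION_singleton_eq_range)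
    show "module.smult ?Q r C = (\<Union>x\<in>C. coset (r * x))"
      unfolding quotient_module_def
      by (simp only: module.simps smult_regular_module *)
  qed
  have H: "\<phi> \<in> carrier (Hom_to_quotient I) \<longleftrightarrow> \<phi> \<in> I \<rightarrow>\<^sub>E Set.range coset \<and>
     (\<forall>x\<in>I. \<forall>y\<in>I. \<phi> (x + y) = set_add (regular_module mpoly_ring) (\<phi> x) (\<phi> y)) \<and>
     (\<forall>r. \<forall>x\<in>I. \<phi> (r * x) = (\<Union>z\<in>\<phi> x. coset (r * z)))" for \<phi>
    by (simp add: Hom_to_quotient_def Hom_module_def module_homs_def Q add_regular_module
        smult_regular_module)
  show "carrier (Hom_to_quotient I) \<subseteq> hom_of ` Collect (hom_mod I)"
  proof
    fix \<phi> assume \<phi>: "\<phi> \<in> carrier (Hom_to_quotient I)"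
    define F where "F f = (SOME g. \<phi> f = coset g)" for f
    have F: "\<phi> f = coset (F f)" if "f \<in> I" for f
    proof -
      have "\<exists>g. \<phi> f = coset g" using \<phi> that unfolding H by blast
      then show ?thesis unfolding F_def by (rule someI_ex)
    qed
    have "hom_mod I F"
      using \<phi> unfolding H hom_mod_def
      by (simp add: F add_mem mult_mem set_add_coset smult_coset coset_eq_iff)
    moreover have "\<phi> = hom_of F"
      using \<phi> unfolding H hom_of_def by (auto simp: F fun_eq_iff PiE_iff extensional_def)
    ultimately show "\<phi> \<in> hom_of ` Collect (hom_mod I)" by blast
  qed
  show "hom_of ` Collect (hom_mod I) \<subseteq> carrier (Hom_to_quotient I)"
  proof clarify
    fix F assume "hom_mod I F"
    then show "hom_of F \<in> carrier (Hom_to_quotient I)"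
      unfolding H hom_mod_def hom_of_def
      by (simp add: Pi_iff rangeI add_mem mult_mem set_add_coset smult_coset coset_eq_iff)
  qed
qed

lemma add_Hom: "hom_of F \<oplus>\<^bsub>Hom_to_quotient I\<^esub> hom_of G = hom_of (\<lambda>f. F f + G f)"
proof -
  have "(\<lambda>f\<in>I. set_add (regular_module mpoly_ring) (hom_of F f) (hom_of G f)) =
      hom_of (\<lambda>f. F f + G f)"
    by (rule ext) (simp add: hom_of_def set_add_coset)
  then show ?thesis
    by (simp add: Hom_to_quotient_def Hom_module_def quotient_module_def)
qed

lemma hom_mod_diff: "hom_mod I F \<Longrightarrow> hom_mod I G \<Longrightarrow> hom_mod I (\<lambda>f. F f - G f)"
  unfolding hom_mod_def
proof (intro conjI ballI allI; elim conjE)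
  fix f g assume *: "f \<in> I" "g \<in> I" "\<forall>f\<in>I. \<forall>g\<in>I. F (f + g) - (F f + F g) \<in> I"
    "\<forall>f\<in>I. \<forall>g\<in>I. G (f + g) - (G f + G g) \<in> I"
  have "(F (f + g) - (F f + F g)) - (G (f + g) - (G f + G g)) \<in> I"
    by (rule diff_mem) (use * in blast)+
  then show "F (f + g) - G (f + g) - (F f - G f + (F g - G g)) \<in> I" by (simp add: algebra_simps)
next
  fix r f assume *: "f \<in> I" "\<forall>r. \<forall>f\<in>I. F (r * f) - r * F f \<in> I"
    "\<forall>r. \<forall>f\<in>I. G (r * f) - r * G f \<in> I"
  have "(F (r * f) - r * F f) - (G (r * f) - r * G f) \<in> I"
    by (rule diff_mem) (use * in blast)+
  then show "F (r * f) - G (r * f) - r * (F f - G f) \<in> I" by (simp add: algebra_simps)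
qed

lemma hom_mod_add: "hom_mod I F \<Longrightarrow> hom_mod I G \<Longrightarrow> hom_mod I (\<lambda>f. F f + G f)"
  unfolding hom_mod_def
proof (intro conjI ballI allI; elim conjE)
  fix f g assume *: "f \<in> I" "g \<in> I" "\<forall>f\<in>I. \<forall>g\<in>I. F (f + g) - (F f + F g) \<in> I"
    "\<forall>f\<in>I. \<forall>g\<in>I. G (f + g) - (G f + G g) \<in> I"
  have "(F (f + g) - (F f + F g)) + (G (f + g) - (G f + G g)) \<in> I"
    by (rule add_mem) (use * in blast)+
  then show "F (f + g) + G (f + g) - (F f + G f + (F g + G g)) \<in> I" by (simp add: algebra_simps)
next
  fix r f assume *: "f \<in> I" "\<forall>r. \<forall>f\<in>I. F (r * f) - r * F f \<in> I"
    "\<forall>r. \<forall>f\<in>I. G (r * f) - r * G f \<in> I"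
  have "(F (r * f) - r * F f) + (G (r * f) - r * G f) \<in> I"
    by (rule add_mem) (use * in blast)+
  then show "F (r * f) + G (r * f) - r * (F f + G f) \<in> I" by (simp add: algebra_simps)
qed

lemma hom_mod_Der:
  assumes "\<delta> \<in> Der"
  shows "hom_mod I \<delta>"
proof -
  have "\<delta> (f + g) = \<delta> f + \<delta> g" "\<delta> (f * g) = f * \<delta> g + \<delta> f * g" for f g
    using assms unfolding Der_def by blast+
  then show ?thesis
    unfolding hom_mod_def by (simp add: zero_mem mult_mem)
qed

text \<open>The quotient vanishes iff every coset of the image of \<open>Der\<close> is that image
  itself, that is, iff each homomorphism agrees modulo \<open>I\<close> with a derivation.\<close>

lemma T1_zero_iff:
  "carrier (T1 I) = {\<zero>\<^bsub>T1 I\<^esub>} \<longleftrightarrow>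
     (\<forall>F. hom_mod I F \<longrightarrow> (\<exists>\<delta>\<in>Der. \<forall>f\<in>I. F f - \<delta> f \<in> I))"
proof -
  let ?H = "Hom_to_quotient I"
  let ?N = "hom_of ` Der"
  have N: "delta_star I ` Der = ?N" by (simp add: delta_star_eq)
  have zero: "\<zero>\<^bsub>T1 I\<^esub> = ?N" unfolding T1_def N by (simp add: quotient_module_def)
  have coset: "?N +>\<^bsub>?H\<^esub> hom_of F = {hom_of (\<lambda>f. \<delta> f + F f) | \<delta>. \<delta> \<in> Der}" for F
    by (auto simp: a_r_coset_def' add_Hom)
  have carrier: "carrier (T1 I) = {?N +>\<^bsub>?H\<^esub> hom_of F | F. hom_mod I F}"
    unfolding T1_def N by (auto simp: quotient_module_def A_RCOSETS_def' carrier_Hom)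
  have Der0: "(\<lambda>_. 0) \<in> (Der :: (('n, 'k) mpoly \<Rightarrow> _) set)" by (simp add: Der_def)
  have mem: "hom_of F \<in> ?N \<longleftrightarrow> (\<exists>\<delta>\<in>Der. \<forall>f\<in>I. F f - \<delta> f \<in> I)" for F
    by (auto simp: hom_of_eq_iff image_iff)
  show ?thesis
  proof
    assume L: "carrier (T1 I) = {\<zero>\<^bsub>T1 I\<^esub>}"
    show "\<forall>F. hom_mod I F \<longrightarrow> (\<exists>\<delta>\<in>Der. \<forall>f\<in>I. F f - \<delta> f \<in> I)"
    proof (intro allI impI)
      fix F assume "hom_mod I F"
      then have "?N +>\<^bsub>?H\<^esub> hom_of F \<in> carrier (T1 I)"
        unfolding carrier by (intro CollectI exI[of _ F]) simp
      then have "?N +>\<^bsub>?H\<^esub> hom_of F = ?N" unfolding L zero by (rule singletonD)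
      \<comment> \<open>The zero derivation places \<open>hom_of F\<close> in its own coset.\<close>
      moreover have "hom_of F \<in> ?N +>\<^bsub>?H\<^esub> hom_of F"
        unfolding coset by (intro CollectI exI[of _ "\<lambda>_. 0"] conjI Der0) simp
      ultimately show "\<exists>\<delta>\<in>Der. \<forall>f\<in>I. F f - \<delta> f \<in> I" by (simp only: mem)
    qed
  next
    assume R: "\<forall>F. hom_mod I F \<longrightarrow> (\<exists>\<delta>\<in>Der. \<forall>f\<in>I. F f - \<delta> f \<in> I)"
    have *: "?N +>\<^bsub>?H\<^esub> hom_of F = ?N" if F: "hom_mod I F" for F
    proof
      show "?N +>\<^bsub>?H\<^esub> hom_of F \<subseteq> ?N"
      proof
        fix \<phi> assume "\<phi> \<in> ?N +>\<^bsub>?H\<^esub> hom_of F"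
        then obtain \<delta> where \<delta>: "\<delta> \<in> Der" "\<phi> = hom_of (\<lambda>f. \<delta> f + F f)"
          unfolding coset by blast
        show "\<phi> \<in> ?N"
          unfolding \<delta>(2) mem by (rule R[rule_format, OF hom_mod_add[OF hom_mod_Der[OF \<delta>(1)] F]])
      qed
      show "?N \<subseteq> ?N +>\<^bsub>?H\<^esub> hom_of F"
      proof
        fix \<phi> assume "\<phi> \<in> ?N"
        then obtain G where G: "G \<in> Der" "\<phi> = hom_of G" by blast
        \<comment> \<open>The assumption \<open>R\<close> applied to \<open>G - F\<close> writes
          \<open>G\<close> as \<open>\<delta> + F\<close> modulo \<open>I\<close>; closure of
          \<open>Der\<close> under differences is not invoked.\<close>
        obtain \<delta> where \<delta>: "\<delta> \<in> Der" "\<forall>f\<in>I. (G f - F f) - \<delta> f \<in> I"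
          using R[rule_format, OF hom_mod_diff[OF hom_mod_Der[OF G(1)] F]] by blast
        have "\<phi> = hom_of (\<lambda>f. \<delta> f + F f)"
          using \<delta>(2) unfolding G(2) hom_of_eq_iff by (simp add: diff_diff_add add.commute)
        then show "\<phi> \<in> ?N +>\<^bsub>?H\<^esub> hom_of F" 
            unfolding coset by (intro CollectI exI[of _ \<delta>] conjI \<delta>(1))
      qed
    qed
    show "carrier (T1 I) = {\<zero>\<^bsub>T1 I\<^esub>}"
      unfolding carrier zero
    proof (intro equalityI subsetI)
      fix C assume "C \<in> {?N +>\<^bsub>?H\<^esub> hom_of F |F. hom_mod I F}"
      then obtain F where F: "hom_mod I F" "C = ?N +>\<^bsub>?H\<^esub> hom_of F" by blast
      show "C \<in> {?N}" unfolding F(2) *[OF F(1)] by simp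
    next
      fix C assume "C \<in> {?N}"
      then have "C = ?N +>\<^bsub>?H\<^esub> hom_of (\<lambda>_. 0)" using *[OF hom_mod_Der[OF Der0]] by simp
      then show "C \<in> {?N +>\<^bsub>?H\<^esub> hom_of F |F. hom_mod I F}"
        by (intro CollectI exI[of _ "\<lambda>_. 0"] conjI hom_mod_Der[OF Der0])
    qed
  qed
qed

end


section \<open>Edge ideals and shift homomorphisms\<close>

text \<open>In a simple graph the ends of an edge are distinct, so two nonzero exponents already
  mean divisibility by \<open>x_i x_j\<close>: these are the monomials in the edge ideal.\<close>

definition edge_monomial :: "'n set set \<Rightarrow> ('n \<Rightarrow>\<^sub>0 nat) \<Rightarrow> bool" where
  "edge_monomial E m \<longleftrightarrow> (\<exists>i j. {i, j} \<in> E \<and> lookup m i \<noteq> 0 \<and> lookup m j \<noteq> 0)"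

lemma edge_monomial_add: "edge_monomial E m \<Longrightarrow> edge_monomial E (s + m)"
  unfolding edge_monomial_def by (metis add_is_0 lookup_add)

lemma simple_graph_neq: "simple_graph E \<Longrightarrow> {i, j} \<in> E \<Longrightarrow> i \<noteq> j"
  unfolding simple_graph_def by fastforce

lemma lookup_single_mult:
  fixes f :: "('n, 'k::field) mpoly"
  shows "lookup (single s c * f) (s + m) = c * lookup f m"
proof (induction f rule: poly_mapping_add_induct)
  case (single t)
  show ?case by (simp add: mult_single lookup_single when_def)
qed (simp_all add: distrib_left lookup_add)

lemma lookup_single_mult_eq_0:
  fixes f :: "('n, 'k::field) mpoly"
  assumes "\<And>m. n \<noteq> s + m"
  shows "lookup (single s c * f) n = 0"
proof (induction f rule: poly_mapping_add_induct)
  case (single t)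
  then show ?case using assms by (auto simp: mult_single lookup_single when_def)
qed (simp_all add: distrib_left lookup_add)

definition monomial_ideal :: "'n set set \<Rightarrow> ('n, 'k::field) mpoly set" where
  "monomial_ideal E = {f. \<forall>m. lookup f m \<noteq> 0 \<longrightarrow> edge_monomial E m}"

lemma monomial_idealD: "f \<in> monomial_ideal E \<Longrightarrow> \<not> edge_monomial E m \<Longrightarrow> lookup f m = 0"
  by (auto simp: monomial_ideal_def)

lemma mpoly_ideal_monomial_ideal: "mpoly_ideal (monomial_ideal E :: ('n, 'k::field) mpoly set)"
proof
  fix f g r :: "('n, 'k) mpoly"
  show add: "f + g \<in> monomial_ideal E" if "f \<in> monomial_ideal E" "g \<in> monomial_ideal E" for f g :: "('n, 'k) mpoly"
    using that by (auto simp: monomial_ideal_def lookup_add) (metis add_0)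
  show "r * f \<in> monomial_ideal E" if f: "f \<in> monomial_ideal E"
  proof (induction r rule: poly_mapping_add_induct)
    case (single s)
    show ?case
      unfolding monomial_ideal_def
    proof (intro CollectI allI impI)
      fix n assume n: "lookup (single s (lookup r s) * f) n \<noteq> 0"
      then obtain m where m: "n = s + m" using lookup_single_mult_eq_0 by metis
      then have "lookup f m \<noteq> 0" using n by (auto simp: lookup_single_mult)
      then show "edge_monomial E n" using f m edge_monomial_add by (auto simp: monomial_ideal_def)
    qed
  qed (simp_all add: distrib_right add, simp add: monomial_ideal_def)
qed (auto simp: monomial_ideal_def)

lemma Var_mult_Var: "Var i * Var j = single (single i 1 + single j 1) (1 :: 'k::field)"
  by (simp add: Var_def mult_single)

lemma single_mem_monomial_ideal: "edge_monomial E m \<Longrightarrow> single m c \<in> monomial_ideal E"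
  by (auto simp: monomial_ideal_def lookup_single when_def)

lemma Var_mult_Var_mem: "{i, j} \<in> E \<Longrightarrow> Var i * Var j \<in> (monomial_ideal E :: ('n, 'k::field) mpoly set)"
  unfolding Var_mult_Var
  by (rule single_mem_monomial_ideal)
    (unfold edge_monomial_def, intro exI[of _ i] exI[of _ j], simp add: lookup_add)

lemma edge_monomial_factor:
  assumes "simple_graph E" and "edge_monomial E m"
  obtains i j s where "{i, j} \<in> E" and "m = s + (single i 1 + single j 1)"
proof -
  obtain i j where ij: "{i, j} \<in> E" "lookup m i \<noteq> 0" "lookup m j \<noteq> 0"
    using assms(2) by (auto simp: edge_monomial_def)
  have "m = (m - (single i 1 + single j 1)) + (single i 1 + single j 1)"
    using ij simple_graph_neq[OF assms(1) ij(1)]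
    by (intro poly_mapping_eqI) (auto simp: lookup_add lookup_minus lookup_single when_def)
  then show ?thesis using ij(1) that by blast
qed

text \<open>Every term of \<open>f\<close> lies in the ideal itself and is a multiple of some edge
  generator, so the multiples of generators are the only essential case.\<close>

lemma monomial_ideal_induct [consumes 2, case_names zero gen add]:
  fixes f :: "('n, 'k::field) mpoly"
  assumes f: "f \<in> monomial_ideal E" and E: "simple_graph E"
    and "P 0" and "\<And>r i j. {i, j} \<in> E \<Longrightarrow> P (r * (Var i * Var j))"
    and "\<And>g h. g \<in> monomial_ideal E \<Longrightarrow> h \<in> monomial_ideal E \<Longrightarrow> P g \<Longrightarrow> P h \<Longrightarrow> P (g + h)"
  shows "P f"
proof -
  interpret mpoly_ideal "monomial_ideal E :: ('n, 'k) mpoly set" by (rule mpoly_ideal_monomial_ideal)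
  have "f \<in> monomial_ideal E \<and> P f"
  proof (induction f rule: poly_mapping_add_induct)
    case (single m)
    then have m: "edge_monomial E m" using f by (auto simp: monomial_ideal_def)
    then obtain i j s where ij: "{i, j} \<in> E" and s: "m = s + (single i 1 + single j 1)"
      using edge_monomial_factor[OF E] by blast
    have "single m (lookup f m) = single s (lookup f m) * (Var i * Var j)"
      unfolding Var_mult_Var by (simp add: mult_single s)
    then show ?case using assms(4)[OF ij] single_mem_monomial_ideal[OF m] by metis
  qed (use assms zero_mem add_mem in auto)
  then show ?thesis by simp
qed

text \<open>One inclusion is minimality of the generated ideal, the other is induction over
  multiples of generators. Membership thereby becomes a condition on single coefficients.\<close>

lemma edge_ideal_eq:
  fixes E :: "'n set set"
  assumes E: "simple_graph E"
  shows "edge_ideal E = (monomial_ideal E :: ('n, 'k::field) mpoly set)"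
proof
  interpret mpoly_ideal "monomial_ideal E :: ('n, 'k) mpoly set" by (rule mpoly_ideal_monomial_ideal)
  interpret R: ring "mpoly_ring :: ('n, 'k) mpoly ring" by (rule ring_mpoly_ring)
  let ?G = "{Var i * Var j | i j. {i, j} \<in> E} :: ('n, 'k) mpoly set"
  have "subgroup (monomial_ideal E) (add_monoid (mpoly_ring :: ('n, 'k) mpoly ring))"
  proof (rule R.add.subgroupI)
    fix f :: "('n, 'k) mpoly" assume "f \<in> monomial_ideal E"
    moreover have "\<ominus>\<^bsub>mpoly_ring\<^esub> f = - f" by (rule R.minus_equality) simp_all
    ultimately show "\<ominus>\<^bsub>mpoly_ring\<^esub> f \<in> monomial_ideal E"
      by (simp only: uminus_mem)
  qed (use zero_mem add_mem in auto)
  then have "ideal (monomial_ideal E) (mpoly_ring :: ('n, 'k) mpoly ring)"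
    by (intro idealI R.ring_axioms) (auto simp: mult_mem mult_mem_right)
  then show "edge_ideal E \<subseteq> (monomial_ideal E :: ('n, 'k) mpoly set)"
    unfolding edge_ideal_def by (rule R.genideal_minimal) (auto intro: Var_mult_Var_mem)
  interpret J: ideal "edge_ideal E" "mpoly_ring :: ('n, 'k) mpoly ring"
    unfolding edge_ideal_def by (rule R.genideal_ideal) simp
  have gen: "?G \<subseteq> edge_ideal E" unfolding edge_ideal_def by (rule R.genideal_self) simp
  show "(monomial_ideal E :: ('n, 'k) mpoly set) \<subseteq> edge_ideal E"
  proof
    fix f :: "('n, 'k) mpoly" assume "f \<in> monomial_ideal E"
    then show "f \<in> edge_ideal E" using E
    proof (induction rule: monomial_ideal_induct)
      case zero
      then show ?case using J.zero_closed by simp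
    next
      case (gen r i j)
      then show ?case using J.I_l_closed[of "Var i * Var j" r] \<open>?G \<subseteq> _\<close> by auto
    next
      case (add g h)
      then show ?case using J.a_closed by simp
    qed
  qed
qed

lemma rigid_iff:
  fixes E :: "'n set set"
  assumes "simple_graph E"
  shows "rigid TYPE('k::field) E \<longleftrightarrow>
    (\<forall>F. hom_mod (monomial_ideal E :: ('n, 'k) mpoly set) F \<longrightarrow>
      (\<exists>\<delta>\<in>Der. \<forall>f\<in>monomial_ideal E. F f - \<delta> f \<in> monomial_ideal E))"
  unfolding rigid_def edge_ideal_eq[OF assms]
  by (rule mpoly_ideal.T1_zero_iff) (rule mpoly_ideal_monomial_ideal)

section \<open>Shift homomorphisms\<close>

text \<open>The coefficientwise form of \<open>f \<mapsto> x\<^sup>a f / x\<^sup>b\<close>, restricted to the target monomials in \<open>P\<close>.\<close>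

lift_definition shift_restrict ::
  "'m::cancel_comm_monoid_add \<Rightarrow> 'm \<Rightarrow> ('m \<Rightarrow> bool) \<Rightarrow> ('m \<Rightarrow>\<^sub>0 'k::zero) \<Rightarrow> 'm \<Rightarrow>\<^sub>0 'k" is
  "\<lambda>a b P f n. if (\<exists>m. n = m + a) \<and> P n then f (n - a + b) else 0"
proof -
  fix a b :: 'm and P and f :: "'m \<Rightarrow> 'k"
  assume f: "finite {x. f x \<noteq> 0}"
  have "{n. (if (\<exists>m. n = m + a) \<and> P n then f (n - a + b) else 0) \<noteq> 0}
     \<subseteq> (\<lambda>m. m - b + a) ` {x. f x \<noteq> 0}"
  proof
    fix n assume "n \<in> {n. (if (\<exists>m. n = m + a) \<and> P n then f (n - a + b) else 0) \<noteq> 0}"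
    then obtain m where "n = m + a" "f (m + b) \<noteq> 0" by (auto split: if_splits)
    then show "n \<in> (\<lambda>m. m - b + a) ` {x. f x \<noteq> 0}" by (intro image_eqI[of _ _ "m + b"]) auto
  qed
  then show "finite {n. (if (\<exists>m. n = m + a) \<and> P n then f (n - a + b) else 0) \<noteq> 0}"
    using f finite_surj by blast
qed

lemma lookup_shift_restrict: "lookup (shift_restrict a b P f) (m + a) = (if P (m + a) then lookup f (m + b) else 0)"
  by (simp add: shift_restrict.rep_eq)

lemma lookup_shift_restrict_0: "(\<And>m. n \<noteq> m + a) \<Longrightarrow> lookup (shift_restrict a b P f) n = 0"
  by (simp add: shift_restrict.rep_eq)

lemma shift_restrict_add:
  fixes f g :: "'m::cancel_comm_monoid_add \<Rightarrow>\<^sub>0 'k::comm_monoid_add"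
  shows "shift_restrict a b P (f + g) = shift_restrict a b P f + shift_restrict a b P g"
  by (rule poly_mapping_eqI) (simp add: shift_restrict.rep_eq lookup_add)

lemma shift_restrict_0: "shift_restrict a b P 0 = 0"
  by (rule poly_mapping_eqI) (simp add: shift_restrict.rep_eq)

text \<open>The shift commutes with multiplication by \<open>x^s\<close> except where
  \<open>x^s x^m\<close> has an admissible shift and \<open>x^m\<close> has none. Condition
  \<open>ob\<close> puts the resulting monomials into \<open>I\<close>, so the defect vanishes
  modulo \<open>I\<close>.\<close>

lemma hom_mod_shift_restrict:
  fixes a b :: "'n \<Rightarrow>\<^sub>0 nat"
  assumes P: "\<And>n s. P n \<Longrightarrow> P (s + n)"
    and ob: "\<And>m n s. edge_monomial E m \<Longrightarrow> s + m = n + b \<Longrightarrow> P (n + a) \<Longrightarrow>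
      (\<And>k. m = k + b \<Longrightarrow> \<not> P (k + a)) \<Longrightarrow> edge_monomial E (n + a)"
  shows "hom_mod (monomial_ideal E :: ('n, 'k::field) mpoly set) (shift_restrict a b P)"
proof -
  let ?I = "monomial_ideal E :: ('n, 'k) mpoly set" and ?F = "shift_restrict a b P :: ('n, 'k) mpoly \<Rightarrow> _"
  interpret mpoly_ideal ?I by (rule mpoly_ideal_monomial_ideal)
  have single: "?F (single s c * single m d) - single s c * ?F (single m d) \<in> ?I"
    if m: "edge_monomial E m" for s m c d
    unfolding monomial_ideal_def
  proof (intro CollectI allI impI)
    fix n assume n: "lookup (?F (single s c * single m d) - single s c * ?F (single m d)) n \<noteq> 0"
    show "edge_monomial E n"
    proof (cases "lookup (single s c * ?F (single m d)) n = 0")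
      \<comment> \<open>Only the shift of the product contributes at \<open>n\<close>, so
        \<open>m\<close> has no admissible shift and \<open>ob\<close> applies.\<close>
      case True
      then have nz: "lookup (?F (single s c * single m d)) n \<noteq> 0" using n by (simp add: lookup_minus)
      then obtain k where k: "n = k + a" using lookup_shift_restrict_0 by metis
      have Pk: "P (k + a)" and sm: "s + m = k + b" and cd: "c * d \<noteq> 0"
        using nz unfolding k by (auto simp: lookup_shift_restrict mult_single lookup_single when_def split: if_splits)
      show ?thesis unfolding k
      proof (rule ob[OF m sm Pk])
        fix l assume l: "m = l + b"
        have "n = s + (l + a)" using sm unfolding l k by (metis add.assoc add.commute add_right_cancel)
        then show "\<not> P (l + a)"
          using True cd by (auto simp: lookup_single_mult lookup_shift_restrict l)
      qed
    next
      \<comment> \<open>Here \<open>m\<close> has an admissible shift. Since \<open>P\<close> is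
        closed under multiples, both terms have coefficient \<open>c * d\<close> at \<open>n\<close>
        and cancel, contrary to the choice of \<open>n\<close>.\<close>
      case False
      then obtain k where k: "n = s + k" using lookup_single_mult_eq_0 by metis
      have nz: "c * lookup (?F (single m d)) k \<noteq> 0" using False by (simp add: k lookup_single_mult)
      then obtain l where l: "k = l + a" using lookup_shift_restrict_0 by (metis mult_zero_right)
      have Pl: "P (l + a)" and m: "m = l + b"
        using nz unfolding l by (auto simp: lookup_shift_restrict lookup_single when_def split: if_splits)
      have n': "n = (s + l) + a" by (simp add: k l add.assoc)
      have "P ((s + l) + a)" using P[OF Pl, of s] by (simp add: add.assoc)
      then have "lookup (?F (single s c * single m d)) n = c * d"
        unfolding n' lookup_shift_restrict by (simp add: mult_single m add.assoc)
      moreover have "lookup (single s c * ?F (single m d)) n = c * d"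
        using Pl by (simp add: k l lookup_single_mult lookup_shift_restrict m)
      ultimately show ?thesis using n by (simp add: lookup_minus)
    qed
  qed
  have "?F (r * f) - r * ?F f \<in> ?I" if "f \<in> ?I" for r f
  proof -
    have 1: "?F (r * single m d) - r * ?F (single m d) \<in> ?I" if "edge_monomial E m" for m d
    proof (induction r rule: poly_mapping_add_induct)
      case (add g h)
      then show ?case
        using add_mem[OF add] by (simp add: distrib_right shift_restrict_add algebra_simps)
    qed (use single that zero_mem in \<open>auto simp: shift_restrict_0\<close>)
    show ?thesis
    proof (induction f rule: poly_mapping_add_induct)
      case (single m)
      then show ?case using 1 that monomial_idealD by blast
    next
      case (add g h)
      then show ?case
        using add_mem[OF add] by (simp add: distrib_left shift_restrict_add algebra_simps)
    qed (use zero_mem in \<open>auto simp: shift_restrict_0\<close>)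
  qed
  then show ?thesis unfolding hom_mod_def by (simp add: shift_restrict_add zero_mem)
qed


section \<open>Obstructions to rigidity\<close>

lemma lookup_Var_mult:
  fixes f :: "('n, 'k::field) mpoly"
  shows "lookup (Var i * f) (single i 1 + m) = lookup f m"
  unfolding Var_def by (simp add: lookup_single_mult)

lemma lookup_Var_mult_eq_0:
  fixes f :: "('n, 'k::field) mpoly"
  assumes "lookup n i = 0"
  shows "lookup (Var i * f) n = 0"
  unfolding Var_def by (rule lookup_single_mult_eq_0) (use assms in \<open>auto simp: lookup_add\<close>)

lemma Der_add: "\<delta> \<in> Der \<Longrightarrow> \<delta> (f + g) = \<delta> f + \<delta> g"
  and Der_mult: "\<delta> \<in> Der \<Longrightarrow> \<delta> (f * g) = f * \<delta> g + \<delta> f * g"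
  unfolding Der_def by blast+

definition set_monomial :: "'n::finite set \<Rightarrow> ('n \<Rightarrow>\<^sub>0 nat)" where
  "set_monomial A = Abs_poly_mapping (\<lambda>v. if v \<in> A then 1 else 0)"

lemma lookup_set_monomial [simp]: "lookup (set_monomial A) v = (if v \<in> A then 1 else 0)"
  by (simp add: set_monomial_def)

definition neighbours :: "'n set set \<Rightarrow> 'n set \<Rightarrow> 'n set" where
  "neighbours E A = {v. \<exists>u\<in>A. {u, v} \<in> E}"

lemma neighbours_iff: "v \<in> neighbours E A \<longleftrightarrow> (\<exists>u\<in>A. {v, u} \<in> E)"
  by (simp add: neighbours_def insert_commute)

text \<open>The support of this monomial is \<open>insert j A\<close>, an independent set, so its
  coefficient is still visible in \<open>S/I\<close>.\<close>

lemma edge_monomial_set_monomial_add_single: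
  assumes "simple_graph E" and "A \<inter> neighbours E A = {}" and "j \<notin> neighbours E A"
  shows "\<not> edge_monomial E (single j 1 + set_monomial A)"
proof
  assume "edge_monomial E (single j 1 + set_monomial A)"
  moreover have "lookup (single j 1 + set_monomial A) p \<noteq> 0 \<longleftrightarrow> p \<in> insert j A" for p
    by (auto simp: lookup_add lookup_single when_def)
  ultimately obtain p q where pq: "{p, q} \<in> E" "p \<in> insert j A" "q \<in> insert j A"
    unfolding edge_monomial_def by blast
  then show False
    using assms simple_graph_neq[OF assms(1) pq(1)] unfolding neighbours_def
    by (auto simp: insert_commute)
qed

text \<open>The product rule on a generator, read at a monomial outside \<open>I\<close>. Both
  obstructions below contradict this equation between coefficients.\<close>

lemma rigid_imp_hom_mod_Der:
  fixes E :: "'n set set" and F :: "('n, 'k::field) mpoly \<Rightarrow> ('n, 'k) mpoly"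
  assumes "simple_graph E" and "rigid TYPE('k) E" and "hom_mod (monomial_ideal E) F"
  obtains \<delta> where "\<delta> \<in> Der"
    and "\<And>i j n. {i, j} \<in> E \<Longrightarrow> \<not> edge_monomial E n \<Longrightarrow>
      lookup (F (Var i * Var j)) n = lookup (Var i * \<delta> (Var j)) n + lookup (Var j * \<delta> (Var i)) n"
proof -
  obtain \<delta> where \<delta>: "\<delta> \<in> Der" "\<forall>f\<in>monomial_ideal E. F f - \<delta> f \<in> monomial_ideal E"
    using assms rigid_iff[OF assms(1)] by blast
  show ?thesis
  proof (rule that[OF \<delta>(1)])
    fix i j n assume ij: "{i, j} \<in> E" and n: "\<not> edge_monomial E n"
    have "F (Var i * Var j) - \<delta> (Var i * Var j) \<in> monomial_ideal E"
      using \<delta>(2) Var_mult_Var_mem[OF ij] by blast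
    then show "lookup (F (Var i * Var j)) n =
        lookup (Var i * \<delta> (Var j)) n + lookup (Var j * \<delta> (Var i)) n"
      using monomial_idealD[OF _ n] by (fastforce simp: Der_mult[OF \<delta>(1)] lookup_add lookup_minus mult.commute)
  qed
qed

text \<open>For a derivation, the coefficient of \<open>a x_v\<close> in the image of
  \<open>x_i x_v\<close> is that of \<open>a\<close> in \<open>\<delta> (Var i)\<close>, the same
  for all neighbours \<open>v\<close> of \<open>i\<close> outside \<open>N(A)\<close>. The
  restricted shift yields 1 for \<open>v = j\<close> and 0 for \<open>v = k\<close>.\<close>

lemma not_rigid_dominating_neighbour:
  fixes E :: "'n::finite set set"
  assumes E: "simple_graph E" and A: "A \<inter> neighbours E A = {}"
    and i: "i \<notin> A" "i \<notin> neighbours E A"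
    and j: "{i, j} \<in> E" "j \<notin> neighbours E A"
    and k: "{i, k} \<in> E" "k \<notin> neighbours E A" "k \<noteq> j"
    and dom: "\<And>l. {i, l} \<in> E \<Longrightarrow> l \<noteq> j \<Longrightarrow> l \<notin> neighbours E A \<Longrightarrow> {j, l} \<in> E"
  shows "\<not> rigid TYPE('k::field) E"
proof
  assume R: "rigid TYPE('k) E"
  let ?a = "set_monomial A" and ?b = "single i (1::nat)" and ?P = "\<lambda>n :: 'n \<Rightarrow>\<^sub>0 nat. lookup n j \<noteq> 0"
  let ?F = "shift_restrict ?a ?b ?P :: ('n, 'k) mpoly \<Rightarrow> _"
  have ij: "i \<noteq> j" "i \<noteq> k" using simple_graph_neq[OF E] j k by auto
  have jA: "j \<notin> A" "k \<notin> A" using i(2) j(1) k(1) by (auto simp: neighbours_def insert_commute)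
  have hom: "hom_mod (monomial_ideal E) ?F"
  proof (rule hom_mod_shift_restrict)
    fix m n s assume m: "edge_monomial E m" and eq: "s + m = n + ?b"
      and Pn: "lookup (n + ?a) j \<noteq> 0" and none: "\<And>k. m = k + ?b \<Longrightarrow> \<not> lookup (k + ?a) j \<noteq> 0"
    \<comment> \<open>Division by \<open>x_i\<close> lowers only the exponent at
      \<open>i\<close>.\<close>
    have n: "lookup n v \<noteq> 0" if "lookup m v \<noteq> 0" "v \<noteq> i" for v
    proof -
      have "lookup s v + lookup m v = lookup n v + lookup ?b v" using eq by (metis lookup_add)
      then show ?thesis using that by (simp add: lookup_single when_def)
    qed
    obtain p q where pq: "{p, q} \<in> E" "lookup m p \<noteq> 0" "lookup m q \<noteq> 0"
      using m by (auto simp: edge_monomial_def)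
    consider "p \<noteq> i" "q \<noteq> i" | q' where "lookup m i \<noteq> 0" "{i, q'} \<in> E" "lookup m q' \<noteq> 0" "q' \<noteq> i"
      using pq simple_graph_neq[OF E pq(1)] by (metis insert_commute)
    then show "edge_monomial E (n + ?a)"
    proof cases
      case 1
      then show ?thesis using pq n unfolding edge_monomial_def by (metis add_is_0 lookup_add)
    next
      \<comment> \<open>As \<open>x_i\<close> divides \<open>m\<close>, the shift of
        \<open>m\<close> can fail only because its target is not divisible by \<open>x_j\<close>; so
        \<open>q'\<close> is not \<open>j\<close>. By \<open>dom\<close>, \<open>q'\<close> then has
        a neighbour in \<open>insert j A\<close>, and all of these variables divide the
        target.\<close>
      case 2
      have "m = (m - ?b) + ?b"
        by (rule poly_mapping_eqI) (use 2 in \<open>auto simp: lookup_add lookup_minus lookup_single when_def\<close>)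
      then have "lookup ((m - ?b) + ?a) j = 0" using none by blast
      then have "q' \<noteq> j" using 2 ij by (auto simp: lookup_add lookup_minus lookup_single when_def)
      then have "{j, q'} \<in> E \<or> (\<exists>u\<in>A. {u, q'} \<in> E)" using dom[OF 2(2)] by (auto simp: neighbours_def)
      moreover have "lookup (n + ?a) q' \<noteq> 0" using n[OF 2(3,4)] by (simp add: lookup_add)
      moreover have "lookup (n + ?a) u \<noteq> 0" if "u \<in> A" for u using that by (simp add: lookup_add)
      ultimately show ?thesis using Pn unfolding edge_monomial_def by blast
    qed
  qed (simp add: lookup_add)
  obtain \<delta> :: "('n, 'k) mpoly \<Rightarrow> ('n, 'k) mpoly" where \<delta>: "\<delta> \<in> Der" and eq: "\<And>i j n. {i, j} \<in> E \<Longrightarrow> \<not> edge_monomial E n \<Longrightarrow>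
      lookup (?F (Var i * Var j)) n = lookup (Var i * \<delta> (Var j)) n + lookup (Var j * \<delta> (Var i)) n"
    by (fact rigid_imp_hom_mod_Der[OF E R hom])
  have F: "lookup (?F (Var i * Var v)) (single v 1 + ?a) = (if lookup (single v 1 + ?a) j \<noteq> 0 then 1 else 0)" for v
    unfolding lookup_shift_restrict Var_mult_Var by (simp add: add.commute)
  \<comment> \<open>The summand \<open>Var i * \<delta> (Var v)\<close> drops out because
    \<open>x_i\<close> does not divide \<open>a x_v\<close>.\<close>
  have *: "lookup (?F (Var i * Var v)) (single v 1 + ?a) = lookup (\<delta> (Var i)) ?a"
    if "{i, v} \<in> E" "v \<notin> neighbours E A" "i \<noteq> v" for v
    using eq[OF that(1) edge_monomial_set_monomial_add_single[OF E A that(2)]] that(3) i(1)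
    unfolding lookup_Var_mult by (subst (asm) lookup_Var_mult_eq_0) (auto simp: lookup_add lookup_single when_def)
  have "lookup (\<delta> (Var i)) ?a = 1"
    using F[of j] *[OF j ij(1)] by (simp add: lookup_add)
  moreover have "lookup (\<delta> (Var i)) ?a = 0"
    using F[of k] *[OF k(1,2) ij(2)] k(3) jA by (simp add: lookup_add lookup_single when_def)
  ultimately show False by simp
qed

text \<open>The shift sends \<open>x_i x_j\<close> to \<open>a\<close>, whereas a derivation sends
  it to a polynomial all of whose terms are divisible by \<open>x_i\<close> or \<open>x_j\<close>;
  \<open>a\<close> is divisible by neither.\<close>

lemma not_rigid_isolated_edge:
  fixes E :: "'n::finite set set"
  assumes E: "simple_graph E" and A: "A \<inter> neighbours E A = {}"
    and ij: "{i, j} \<in> E" "i \<notin> A" "j \<notin> A"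
    and i: "\<And>k. {i, k} \<in> E \<Longrightarrow> k \<noteq> j \<Longrightarrow> k \<in> neighbours E A"
    and j: "\<And>k. {j, k} \<in> E \<Longrightarrow> k \<noteq> i \<Longrightarrow> k \<in> neighbours E A"
  shows "\<not> rigid TYPE('k::field) E"
proof
  assume R: "rigid TYPE('k) E"
  let ?a = "set_monomial A" and ?b = "single i 1 + single j (1::nat)"
  let ?F = "shift_restrict ?a ?b (\<lambda>_. True) :: ('n, 'k) mpoly \<Rightarrow> _"
  have neq: "i \<noteq> j" using simple_graph_neq[OF E ij(1)] .
  have hom: "hom_mod (monomial_ideal E) ?F"
  proof (rule hom_mod_shift_restrict)
    fix m n s assume m: "edge_monomial E m" and eq: "s + m = n + ?b"
      and none: "\<And>k. m = k + ?b \<Longrightarrow> \<not> True"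
    have n: "lookup n v \<noteq> 0" if "lookup m v \<noteq> 0" "v \<noteq> i" "v \<noteq> j" for v
    proof -
      have "lookup s v + lookup m v = lookup n v + lookup ?b v" using eq by (metis lookup_add)
      then show ?thesis using that by (simp add: lookup_add lookup_single when_def)
    qed
    have "m = (m - ?b) + ?b" if "lookup m i \<noteq> 0" "lookup m j \<noteq> 0"
      by (rule poly_mapping_eqI)
        (use that neq in \<open>auto simp: lookup_add lookup_minus lookup_single when_def\<close>)
    then have "lookup m i = 0 \<or> lookup m j = 0" using none by blast
    moreover obtain p q where pq: "{p, q} \<in> E" "lookup m p \<noteq> 0" "lookup m q \<noteq> 0"
      using m by (auto simp: edge_monomial_def)
    \<comment> \<open>The edge \<open>pq\<close> is not \<open>ij\<close>. If it meets
      \<open>ij\<close>, its other end lies in \<open>N(A)\<close> by the isolation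
      hypotheses.\<close>
    ultimately consider "p \<noteq> i" "q \<noteq> i" "p \<noteq> j" "q \<noteq> j"
      | v where "v \<in> neighbours E A" "lookup m v \<noteq> 0" "v \<noteq> i" "v \<noteq> j"
      using i j simple_graph_neq[OF E pq(1)] by (metis insert_commute)
    then show "edge_monomial E (n + ?a)"
    proof cases
      case 1
      then show ?thesis using pq n unfolding edge_monomial_def by (metis add_is_0 lookup_add)
    next
      case 2
      then obtain u where "u \<in> A" "{u, v} \<in> E" by (auto simp: neighbours_def)
      moreover have "lookup (n + ?a) v \<noteq> 0" using n[OF 2(2-)] by (simp add: lookup_add)
      ultimately show ?thesis
        unfolding edge_monomial_def by (intro exI[of _ u] exI[of _ v]) (simp add: lookup_add)
    qed
  qed simp
  obtain \<delta> :: "('n, 'k) mpoly \<Rightarrow> ('n, 'k) mpoly" where \<delta>: "\<delta> \<in> Der" and eq: "\<And>i j n. {i, j} \<in> E \<Longrightarrow> \<not> edge_monomial E n \<Longrightarrow>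
      lookup (?F (Var i * Var j)) n = lookup (Var i * \<delta> (Var j)) n + lookup (Var j * \<delta> (Var i)) n"
    by (fact rigid_imp_hom_mod_Der[OF E R hom])
  have a: "\<not> edge_monomial E ?a"
    using A by (auto simp: edge_monomial_def neighbours_def split: if_splits)
  have "lookup (?F (Var i * Var j)) (0 + ?a) = 1"
    unfolding lookup_shift_restrict Var_mult_Var by simp
  moreover have "lookup (?F (Var i * Var j)) ?a = 0"
    unfolding eq[OF ij(1) a] using ij by (simp add: lookup_Var_mult_eq_0)
  ultimately show False by simp
qed


section \<open>A sufficient condition for rigidity\<close>

lift_definition partial_deriv :: "'n \<Rightarrow> ('n, 'k::field) mpoly \<Rightarrow> (('n \<Rightarrow>\<^sub>0 nat) \<Rightarrow>\<^sub>0 'k)" is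
  "\<lambda>i f n. of_nat (lookup n i + 1) * f (n + single i 1)"
proof -
  fix i :: 'n and f :: "('n \<Rightarrow>\<^sub>0 nat) \<Rightarrow> 'k" assume f: "finite {x. f x \<noteq> 0}"
  have "{n. of_nat (lookup n i + 1) * f (n + single i 1) \<noteq> 0} \<subseteq> (\<lambda>n. n - single i 1) ` {x. f x \<noteq> 0}"
    by (auto intro!: image_eqI[of _ _ "_ + _"])
  then show "finite {n. of_nat (lookup n i + 1) * f (n + single i 1) \<noteq> 0}"
    using f finite_surj by blast
qed

lemma partial_deriv_add: "partial_deriv i (f + g) = partial_deriv i f + partial_deriv i g"
  by (rule poly_mapping_eqI) (simp add: partial_deriv.rep_eq lookup_add algebra_simps)

lemma partial_deriv_0: "partial_deriv i 0 = 0"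
  by (rule poly_mapping_eqI) (simp add: partial_deriv.rep_eq)

text \<open>When the exponent at \<open>i\<close> is 0, the truncated \<open>m - single i 1\<close>
  does no harm, since the coefficient is then 0.\<close>

lemma partial_deriv_single:
  "partial_deriv i (single m c) = single (m - single i 1) (of_nat (lookup m i) * c)"
proof (cases "lookup m i = 0")
  case True
  then have "m \<noteq> n + single i 1" for n by (auto simp: lookup_add)
  then show ?thesis
    using True by (intro poly_mapping_eqI) (auto simp: partial_deriv.rep_eq lookup_single when_def)
next
  case False
  then have "m = (m - single i 1) + single i 1"
    by (intro poly_mapping_eqI) (auto simp: lookup_add lookup_minus lookup_single when_def)
  then obtain l where m: "m = l + single i 1" by blast
  show ?thesis
    by (rule poly_mapping_eqI)
      (auto simp: m partial_deriv.rep_eq lookup_single lookup_add when_def)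
qed

lemma partial_deriv_mult: "partial_deriv i (f * g) = f * partial_deriv i g + partial_deriv i f * g"
proof -
  have diff: "s + t - single i 1 = s + (t - single i 1)" if "lookup t i \<noteq> 0" for s t :: "'a \<Rightarrow>\<^sub>0 nat"
    using that by (intro poly_mapping_eqI) (auto simp: lookup_add lookup_minus lookup_single when_def)
  have single: "partial_deriv i (single s c * single t d) =
      single s c * partial_deriv i (single t d) + partial_deriv i (single s c) * single t d"
    for s t and c d :: 'b
  proof -
    have 1: "single s c * partial_deriv i (single t d) = single (s + t - single i 1) (of_nat (lookup t i) * c * d)"
      using diff[of t s] by (cases "lookup t i = 0") (simp_all add: partial_deriv_single mult_single mult_ac)
    have 2: "partial_deriv i (single s c) * single t d = single (s + t - single i 1) (of_nat (lookup s i) * c * d)"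
      using diff[of s t] by (cases "lookup s i = 0") (simp_all add: partial_deriv_single mult_single ac_simps)
    show ?thesis unfolding 1 2
      by (simp add: partial_deriv_single mult_single lookup_add algebra_simps flip: single_add)
  qed
  have *: "partial_deriv i (single s c * g) = single s c * partial_deriv i g + partial_deriv i (single s c) * g" for s c
    by (induction g rule: poly_mapping_add_induct)
      (simp_all add: single partial_deriv_0 partial_deriv_add distrib_left add_ac)
  show ?thesis
    by (induction f rule: poly_mapping_add_induct)
      (simp_all add: * partial_deriv_0 partial_deriv_add distrib_right add_ac)
qed

lemma partial_deriv_Const: "partial_deriv i (Const c) = 0"
  by (simp add: Const_def partial_deriv_single)

lemma partial_deriv_Var: "partial_deriv i (Var j) = (if i = j then 1 else 0)"
  by (simp add: Var_def partial_deriv_single lookup_single when_def)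

text \<open>The derivation is the combination of the partial derivatives with coefficients
  \<open>g i\<close>.\<close>

lemma Der_exists:
  fixes g :: "'n::finite \<Rightarrow> ('n, 'k::field) mpoly"
  obtains \<delta> where "\<delta> \<in> Der" and "\<And>i. \<delta> (Var i) = g i"
proof
  let ?\<delta> = "\<lambda>f. \<Sum>i\<in>UNIV. g i * partial_deriv i f"
  show "?\<delta> \<in> Der"
    unfolding Der_def
    by (auto simp: partial_deriv_add partial_deriv_mult partial_deriv_Const sum.distrib sum_distrib_left
        sum_distrib_right algebra_simps)
  show "?\<delta> (Var i) = g i" for i
    by (simp add: partial_deriv_Var if_distrib cong: if_cong)
qed

text \<open>A free vertex \<open>l\<close> together with the vertex \<open>i\<close> it hangs on;
  arguments about leaves need to name the attachment vertex.\<close>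

definition pendant :: "'n set set \<Rightarrow> 'n \<Rightarrow> 'n \<Rightarrow> bool" where
  "pendant E l i \<longleftrightarrow> (\<forall>v. {l, v} \<in> E \<longleftrightarrow> v = i)"

lemma edge_monomial_single_add:
  assumes "simple_graph E"
  shows "edge_monomial E (single l 1 + m) \<longleftrightarrow>
    edge_monomial E m \<or> (\<exists>v. {l, v} \<in> E \<and> lookup m v \<noteq> 0)"
proof -
  have *: "lookup (single l 1 + m) p \<noteq> 0 \<longleftrightarrow> p = l \<or> lookup m p \<noteq> 0" for p
    by (auto simp: lookup_add lookup_single when_def)
  have "(\<exists>v. {l, v} \<in> E \<and> lookup m v \<noteq> 0)"
    if "{p, q} \<in> E" "p = l \<or> lookup m p \<noteq> 0" "q = l \<or> lookup m q \<noteq> 0" "\<not> edge_monomial E m" for p q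
  proof -
    have "{q, p} \<in> E" using that(1) by (simp add: insert_commute)
    then show ?thesis
      using that simple_graph_neq[OF assms that(1)] unfolding edge_monomial_def by blast
  qed
  then show ?thesis
    unfolding edge_monomial_def * by blast
qed

text \<open>The variable of a pendant vertex can be multiplied in without entering \<open>I\<close>
  as long as \<open>x_i\<close> is absent. This keeps syzygies with pendant edges visible in
  \<open>S/I\<close>.\<close>

lemma edge_monomial_pendant:
  assumes "simple_graph E" and "pendant E l i" and "lookup m i = 0" and "\<not> edge_monomial E m"
  shows "\<not> edge_monomial E (single l 1 + m)"
  using assms unfolding edge_monomial_single_add[OF assms(1)] pendant_def by auto

text \<open>The coefficient of \<open>m\<close> in \<open>\<delta> (Var i)\<close> has to be that of
  \<open>x_j m\<close> in \<open>F (Var i * Var j)\<close>. Hypothesis \<open>triangle\<close> makes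
  this independent of \<open>j\<close>; hypothesis \<open>edge\<close> removes the terms divisible
  by neither \<open>x_i\<close> nor \<open>x_j\<close>, which no derivation could produce.\<close>

lemma rigid_if_pendants:
  fixes E :: "'n::finite set set"
  assumes E: "simple_graph E"
    and edge: "\<And>i j. {i, j} \<in> E \<Longrightarrow> \<exists>k. pendant E k i \<and> k \<noteq> j \<or> pendant E k j \<and> k \<noteq> i"
    and triangle: "\<And>i j k. {i, j} \<in> E \<Longrightarrow> {i, k} \<in> E \<Longrightarrow> {j, k} \<in> E \<Longrightarrow> \<exists>l. pendant E l i"
  shows "rigid TYPE('k::field) E"
  unfolding rigid_iff[OF E]
proof (intro allI impI)
  let ?I = "monomial_ideal E :: ('n, 'k) mpoly set"
  interpret mpoly_ideal ?I by (rule mpoly_ideal_monomial_ideal)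
  fix F assume F: "hom_mod ?I F"
  have F_add: "F (f + g) - (F f + F g) \<in> ?I" if "f \<in> ?I" "g \<in> ?I" for f g
    using F that unfolding hom_mod_def by blast
  have F_mult: "F (r * f) - r * F f \<in> ?I" if "f \<in> ?I" for r f
    using F that unfolding hom_mod_def by blast
  define c where "c i j = lookup (F (Var i * Var j))" for i j
  have c_commute: "c i j = c j i" for i j by (simp add: c_def mult.commute)
  have neq: "i \<noteq> j" if "{i, j} \<in> E" for i j using simple_graph_neq[OF E that] .
  have syz: "lookup (Var k * F (Var i * Var j)) n = lookup (Var j * F (Var i * Var k)) n"
    if "{i, j} \<in> E" "{i, k} \<in> E" "\<not> edge_monomial E n" for i j k n
  proof -
    have "F (Var k * (Var i * Var j)) - Var k * F (Var i * Var j) \<in> ?I"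
      "F (Var j * (Var i * Var k)) - Var j * F (Var i * Var k) \<in> ?I"
      using that by (auto intro!: F_mult Var_mult_Var_mem)
    moreover have "Var k * (Var i * Var j) = Var j * (Var i * Var k :: ('n, 'k) mpoly)"
      by (simp add: ac_simps)
    ultimately have "Var k * F (Var i * Var j) - Var j * F (Var i * Var k) \<in> ?I"
      using diff_trans diff_sym by metis
    then show ?thesis using monomial_idealD[OF _ that(3)] by (fastforce simp: lookup_minus)
  qed
  have nonadj: "c i j (single j 1 + m) = c i k (single k 1 + m)"
    if "{i, j} \<in> E" "{i, k} \<in> E" "{j, k} \<notin> E" "\<not> edge_monomial E (single j 1 + m)"
      "\<not> edge_monomial E (single k 1 + m)" for i j k m
  proof -
    \<comment> \<open>With \<open>j\<close> and \<open>k\<close> nonadjacent, multiplying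
      \<open>x_j m\<close> by \<open>x_k\<close> creates no edge, so the syzygy can be read
      there.\<close>
    have "\<not> edge_monomial E (single k 1 + (single j 1 + m))"
      using that(3-5) unfolding edge_monomial_single_add[OF E]
      by (auto simp: lookup_add lookup_single when_def insert_commute split: if_splits)
    from syz[OF that(1,2) this]
    have "lookup (Var k * F (Var i * Var j)) (single k 1 + (single j 1 + m)) =
        lookup (Var j * F (Var i * Var k)) (single j 1 + (single k 1 + m))"
      by (simp only: add.left_commute)
    then show ?thesis unfolding lookup_Var_mult c_def .
  qed
  have consistent: "c i j (single j 1 + m) = c i k (single k 1 + m)"
    if jk: "{i, j} \<in> E" "{i, k} \<in> E" "\<not> edge_monomial E (single j 1 + m)"
      "\<not> edge_monomial E (single k 1 + m)" for i j k m
  proof (cases "{j, k} \<in> E")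
    case True
    \<comment> \<open>Adjacent \<open>j\<close> and \<open>k\<close> are compared through a pendant
      neighbour \<open>l\<close> of \<open>i\<close>, which is adjacent to neither.\<close>
    then obtain l where l: "pendant E l i" using triangle jk by blast
    have il: "{i, l} \<in> E" using l unfolding pendant_def by (metis insert_commute)
    have mi: "lookup m i = 0"
      using jk(1,3) unfolding edge_monomial_single_add[OF E] by (metis insert_commute)
    have m: "\<not> edge_monomial E m" using jk(3) edge_monomial_add by blast
    have ml: "\<not> edge_monomial E (single l 1 + m)"
      using edge_monomial_pendant[OF E l mi m] .
    have "{j, l} \<notin> E" "{k, l} \<notin> E"
      using l neq[OF jk(1)] neq[OF jk(2)] unfolding pendant_def by (auto simp: insert_commute)
    then show ?thesis using nonadj il jk ml by metis
  qed (use nonadj jk in blast)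
  have vanish: "c i j n = 0"
    if ij: "{i, j} \<in> E" "\<not> edge_monomial E n" "lookup n i = 0" "lookup n j = 0" for i j n
  proof -
    \<comment> \<open>In the syzygy of \<open>x_i x_j\<close> and \<open>x_i x_k\<close>, read at
      \<open>x_k n\<close>, the other side is a multiple of \<open>x_j\<close>, and
      \<open>x_j\<close> does not divide \<open>x_k n\<close>.\<close>
    have *: "c i j n = 0" if "{i, j} \<in> E" "lookup n i = 0" "lookup n j = 0" "pendant E k i" "k \<noteq> j" for i j k
    proof -
      have ik: "{i, k} \<in> E" using that(4) unfolding pendant_def by (metis insert_commute)
      have "\<not> edge_monomial E (single k 1 + n)"
        using edge_monomial_pendant[OF E that(4) that(2) ij(2)] .
      from syz[OF that(1) ik this] show ?thesis
        unfolding lookup_Var_mult c_def using that by (subst (asm) lookup_Var_mult_eq_0) (auto simp: lookup_add lookup_single)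
    qed
    show ?thesis using edge[OF ij(1)] *[of i j] *[of j i] ij c_commute by (metis insert_commute)
  qed
  txt \<open>By \<open>consistent\<close>, the value of \<open>h i m\<close> does not depend on the neighbour of \<open>i\<close> chosen by \<open>w\<close>.\<close>
  define w where "w i m = (SOME j. {i, j} \<in> E \<and> \<not> edge_monomial E (single j 1 + m))" for i m
  define h where "h i m = (if \<exists>j. {i, j} \<in> E \<and> \<not> edge_monomial E (single j 1 + m)
      then c i (w i m) (single (w i m) 1 + m) else 0)" for i m
  have h: "h i m = c i j (single j 1 + m)" if "{i, j} \<in> E" "\<not> edge_monomial E (single j 1 + m)" for i j m
  proof -
    have "{i, w i m} \<in> E \<and> \<not> edge_monomial E (single (w i m) 1 + m)"
      unfolding w_def by (rule someI[of _ j]) (use that in blast)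
    then show ?thesis unfolding h_def using that consistent[of i "w i m" j m] by auto
  qed
  \<comment> \<open>The choice \<open>w i m\<close> varies with \<open>m\<close>, but it ranges over
    finitely many vertices, each contributing a finite support.\<close>
  have fin: "finite {m. h i m \<noteq> 0}" for i
  proof (rule finite_subset)
    show "{m. h i m \<noteq> 0} \<subseteq> (\<Union>j. (\<lambda>n. n - single j 1) ` {n. c i j n \<noteq> 0})"
    proof
      fix m assume "m \<in> {m. h i m \<noteq> 0}"
      then have "c i (w i m) (single (w i m) 1 + m) \<noteq> 0" unfolding h_def by (auto split: if_splits)
      then show "m \<in> (\<Union>j. (\<lambda>n. n - single j 1) ` {n. c i j n \<noteq> 0})"
        by (intro UN_I[of "w i m"] image_eqI[of _ _ "single (w i m) 1 + m"]) auto
    qed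
    show "finite (\<Union>j. (\<lambda>n. n - single j 1) ` {n. c i j n \<noteq> 0})"
      unfolding c_def by simp
  qed
  obtain \<delta> where \<delta>: "\<delta> \<in> Der" "\<And>i. \<delta> (Var i) = Abs_poly_mapping (h i)"
    using Der_exists[of "\<lambda>i. Abs_poly_mapping (h i)"] by blast
  have lookup_\<delta>: "lookup (\<delta> (Var i)) = h i" for i unfolding \<delta>(2) by (simp add: fin)
  have half: "lookup (Var j * \<delta> (Var i)) n = (if lookup n j = 0 then 0 else c i j n)"
    if "{i, j} \<in> E" "\<not> edge_monomial E n" for i j n
  proof (cases "lookup n j = 0")
    case False
    then have "n = single j 1 + (n - single j 1)"
      by (intro poly_mapping_eqI) (auto simp: lookup_add lookup_minus lookup_single when_def)
    then obtain m where m: "n = single j 1 + m" by blast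
    show ?thesis using False h[of i j m] that unfolding m lookup_Var_mult lookup_\<delta> by simp
  qed (simp add: lookup_Var_mult_eq_0)
  have agree: "F (Var i * Var j) - \<delta> (Var i * Var j) \<in> ?I" if ij: "{i, j} \<in> E" for i j
    unfolding monomial_ideal_def
  proof (intro CollectI allI impI, rule ccontr)
    fix n assume nz: "lookup (F (Var i * Var j) - \<delta> (Var i * Var j)) n \<noteq> 0" and n: "\<not> edge_monomial E n"
    have ji: "{j, i} \<in> E" using ij by (simp add: insert_commute)
    have "lookup (\<delta> (Var i * Var j)) n = lookup (Var i * \<delta> (Var j)) n + lookup (Var j * \<delta> (Var i)) n"
      by (simp add: Der_mult[OF \<delta>(1)] lookup_add mult.commute)
    also have "\<dots> = (if lookup n i = 0 then 0 else c i j n) + (if lookup n j = 0 then 0 else c i j n)"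
      unfolding half[OF ij n] half[OF ji n] c_commute[of j i] ..
    \<comment> \<open>At most one of \<open>x_i\<close>, \<open>x_j\<close> divides
      \<open>n\<close>, so the coefficient is not counted twice; if neither does, it is 0 by
      \<open>vanish\<close>.\<close>
    also have "\<dots> = c i j n"
    proof -
      have "lookup n i = 0 \<or> lookup n j = 0" using n ij unfolding edge_monomial_def by blast
      then show ?thesis using vanish[OF ij n] by auto
    qed
    finally show False using nz by (simp add: lookup_minus c_def)
  qed
  have "F f - \<delta> f \<in> ?I" if "f \<in> ?I" for f
    using that E
  proof (induction rule: monomial_ideal_induct)
    case zero
    have "\<delta> 0 = 0" using Der_add[OF \<delta>(1), of 0 0] by simp
    moreover have "F 0 \<in> ?I" using uminus_mem[OF F_add[OF zero_mem zero_mem]] by simp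
    ultimately show ?case by simp
  next
    case (gen r i j)
    let ?x = "Var i * Var j :: ('n, 'k) mpoly"
    have x: "?x \<in> ?I" using gen by (rule Var_mult_Var_mem)
    \<comment> \<open>The product-rule term \<open>\<delta> r * ?x\<close> is harmless, being a
      multiple of a generator.\<close>
    have "(F (r * ?x) - r * F ?x) + r * (F ?x - \<delta> ?x) - \<delta> r * ?x \<in> ?I"
      by (intro diff_mem add_mem F_mult[OF x] mult_mem[OF x] mult_mem agree gen)
    then show ?case unfolding Der_mult[OF \<delta>(1), of r] by (simp add: algebra_simps)
  next
    case (add f g)
    have "(F (f + g) - (F f + F g)) + ((F f - \<delta> f) + (F g - \<delta> g)) \<in> ?I"
      by (intro add_mem F_add add)
    then show ?case unfolding Der_add[OF \<delta>(1)] by (simp add: algebra_simps)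
  qed
  then show "\<exists>\<delta>\<in>Der. \<forall>f\<in>?I. F f - \<delta> f \<in> ?I" using \<delta>(1) by blast
qed


section \<open>Rigid chordal graphs\<close>

lemma chordalE:
  assumes "chordal E" and E: "simple_graph E"
    and "distinct c" "length c \<ge> 4" "cycle_edges c \<subseteq> E"
  obtains u v where "u \<in> set c" "v \<in> set c" "u \<noteq> v" "{u, v} \<in> E" "{u, v} \<notin> cycle_edges c"
proof -
  have "is_cycle E c" using assms by (simp add: is_cycle_def)
  then obtain e where e: "e \<in> E" "e \<subseteq> set c" "e \<notin> cycle_edges c"
    using assms unfolding chordal_def by blast
  moreover from e(1) obtain u v where "e = {u, v}" "u \<noteq> v"
    using E unfolding simple_graph_def by (metis card_2_iff)
  ultimately show ?thesis using that by auto
qed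

lemma cycle_edges_image:
  "cycle_edges c = (\<lambda>i. {c ! i, c ! (Suc i mod length c)}) ` {..<length c}"
  by (auto simp: cycle_edges_def)

lemma cycle_edges_simps:
  "cycle_edges [a, b, c] = {{c, a}, {b, c}, {a, b}}"
  "cycle_edges [a, b, c, d] = {{d, a}, {c, d}, {b, c}, {a, b}}"
  "cycle_edges [a, b, c, d, e] = {{e, a}, {d, e}, {c, d}, {b, c}, {a, b}}"
  "cycle_edges [a, b, c, d, e, f] = {{f, a}, {e, f}, {d, e}, {c, d}, {b, c}, {a, b}}"
  by (simp_all add: cycle_edges_image lessThan_Suc)

lemma chordal_4_cycle:
  assumes "chordal E" "simple_graph E" "distinct [a, b, c, d]"
    and "{a, b} \<in> E" "{b, c} \<in> E" "{c, d} \<in> E" "{d, a} \<in> E"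
  shows "{a, c} \<in> E \<or> {b, d} \<in> E"
proof -
  obtain u v where "u \<in> {a, b, c, d}" "v \<in> {a, b, c, d}" "u \<noteq> v" "{u, v} \<in> E"
    "{u, v} \<notin> cycle_edges [a, b, c, d]"
    by (rule chordalE[OF assms(1-3)]) (use assms in \<open>auto simp: cycle_edges_simps\<close>)
  then show ?thesis
    unfolding cycle_edges_simps by (elim insertE emptyE) (simp_all add: insert_commute)
qed

lemma chordal_5_cycle:
  assumes "chordal E" "simple_graph E" "distinct [a, b, c, d, e]"
    and "{a, b} \<in> E" "{b, c} \<in> E" "{c, d} \<in> E" "{d, e} \<in> E" "{e, a} \<in> E"
  shows "{a, c} \<in> E \<or> {a, d} \<in> E \<or> {b, d} \<in> E \<or> {b, e} \<in> E \<or> {c, e} \<in> E"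
proof -
  obtain u v where "u \<in> {a, b, c, d, e}" "v \<in> {a, b, c, d, e}" "u \<noteq> v" "{u, v} \<in> E"
    "{u, v} \<notin> cycle_edges [a, b, c, d, e]"
    by (rule chordalE[OF assms(1-3)]) (use assms in \<open>auto simp: cycle_edges_simps\<close>)
  then show ?thesis
    unfolding cycle_edges_simps by (elim insertE emptyE) (simp_all add: insert_commute)
qed

lemma chordal_6_cycle:
  assumes "chordal E" "simple_graph E" "distinct [a, b, c, d, e, f]"
    and "{a, b} \<in> E" "{b, c} \<in> E" "{c, d} \<in> E" "{d, e} \<in> E" "{e, f} \<in> E" "{f, a} \<in> E"
  shows "{a, c} \<in> E \<or> {a, d} \<in> E \<or> {a, e} \<in> E \<or> {b, d} \<in> E \<or> {b, e} \<in> E \<or> {b, f} \<in> E \<or>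
    {c, e} \<in> E \<or> {c, f} \<in> E \<or> {d, f} \<in> E"
proof -
  obtain u v where "u \<in> {a, b, c, d, e, f}" "v \<in> {a, b, c, d, e, f}" "u \<noteq> v" "{u, v} \<in> E"
    "{u, v} \<notin> cycle_edges [a, b, c, d, e, f]"
    by (rule chordalE[OF assms(1-3)]) (use assms in \<open>auto simp: cycle_edges_simps\<close>)
  then show ?thesis
    unfolding cycle_edges_simps by (elim insertE emptyE) (simp_all add: insert_commute)
qed

section \<open>Independent sets covering neighbourhoods\<close>

text \<open>Choose \<open>A\<close> covering as much of \<open>W\<close> as possible. If it misses \<open>l\<close>, a neighbour of \<open>u \<in> U\<close>, then
  putting \<open>u\<close> in place of its neighbours in \<open>A\<close> covers more, by the exchange condition.\<close>

lemma independent_cover: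
  fixes E :: "'n::finite set set"
  assumes E: "simple_graph E"
    and exchange: "\<And>l u a m. l \<in> W \<Longrightarrow> u \<in> U \<Longrightarrow> a \<in> U \<Longrightarrow> m \<in> W \<Longrightarrow>
      {l, u} \<in> E \<Longrightarrow> {u, a} \<in> E \<Longrightarrow> {a, m} \<in> E \<Longrightarrow> {l, a} \<notin> E \<Longrightarrow> {u, m} \<in> E"
  obtains A where "A \<subseteq> U" "A \<inter> neighbours E A = {}" "W \<inter> neighbours E U \<subseteq> neighbours E A"
proof -
  let ?P = "\<lambda>A. A \<subseteq> U \<and> A \<inter> neighbours E A = {}" and ?N = "\<lambda>A. W \<inter> neighbours E A"
  have "\<exists>A. ?P A \<and> (\<forall>B. ?P B \<longrightarrow> card (?N B) \<le> card (?N A))"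
    by (rule ex_has_greatest_nat[of _ "{}" _ "Suc (card W)"])
      (auto intro!: card_mono simp: less_Suc_eq_le)
  then obtain A where A: "A \<subseteq> U" "A \<inter> neighbours E A = {}"
    and max: "\<And>B. ?P B \<Longrightarrow> card (?N B) \<le> card (?N A)" by blast
  have "l \<in> neighbours E A" if l: "l \<in> W" "l \<in> neighbours E U" for l
  proof (rule ccontr)
    assume nl: "l \<notin> neighbours E A"
    obtain u where u: "u \<in> U" "{u, l} \<in> E" using l(2) by (auto simp: neighbours_def)
    let ?B = "insert u (A - neighbours E {u})"
    have "?P ?B"
      using A u(1) simple_graph_neq[OF E, of u u] by (auto simp: neighbours_def insert_commute)
    moreover have "?N A \<subset> ?N ?B"
    proof
      show "?N A \<subseteq> ?N ?B"
      proof
        fix m assume "m \<in> ?N A"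
        then obtain a where m: "m \<in> W" "a \<in> A" "{a, m} \<in> E" by (auto simp: neighbours_def)
        show "m \<in> ?N ?B"
        proof (cases "{u, a} \<in> E")
          \<comment> \<open>Here \<open>a\<close> is dropped from \<open>A\<close>, and the exchange
            condition makes \<open>u\<close> cover \<open>m\<close> in its place.\<close>
          case True
          have "{l, a} \<notin> E" using nl m(2) by (auto simp: neighbours_def insert_commute)
          moreover have "{l, u} \<in> E" using u(2) by (simp add: insert_commute)
          ultimately have "{u, m} \<in> E" using exchange l(1) u(1) A(1) m True by blast
          then show ?thesis using m(1) by (auto simp: neighbours_def)
        next
          case False
          then show ?thesis using m by (auto simp: neighbours_def)
        qed
      qed
      have "l \<in> ?N ?B" using l(1) u(2) by (auto simp: neighbours_def)
      then show "?N A \<noteq> ?N ?B" using nl by blast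
    qed
    ultimately show False
      using max[of ?B] psubset_card_mono[of "?N ?B" "?N A"] by (simp add: not_le[symmetric])
  qed
  then show ?thesis using that A by blast
qed

text \<open>In the 5-cycle \<open>i l u a m\<close> the only chords left are \<open>lm\<close> and
  \<open>um\<close>. The former closes the 4-cycle \<open>l u a m\<close>, whose chord must again be
  \<open>um\<close>.\<close>

lemma chordal_exchange:
  assumes "chordal E" and E: "simple_graph E"
    and "{i, l} \<in> E" "{i, m} \<in> E" "{i, u} \<notin> E" "{i, a} \<notin> E" "u \<noteq> i" "a \<noteq> i"
    and "{l, u} \<in> E" "{u, a} \<in> E" "{a, m} \<in> E" "{l, a} \<notin> E"
  shows "{u, m} \<in> E"
proof -
  have neq: "i \<noteq> l" "i \<noteq> m" "l \<noteq> u" "u \<noteq> a" "a \<noteq> m" "l \<noteq> m" "l \<noteq> a" "u \<noteq> m"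
    using assms simple_graph_neq[OF E] by (auto simp: insert_commute)
  have "{i, u} \<in> E \<or> {i, a} \<in> E \<or> {l, a} \<in> E \<or> {l, m} \<in> E \<or> {u, m} \<in> E"
    by (rule chordal_5_cycle[OF assms(1,2)]) (use assms neq in \<open>auto simp: insert_commute\<close>)
  then consider "{l, m} \<in> E" | "{u, m} \<in> E" using assms by blast
  then show ?thesis
  proof cases
    case 1
    have "{l, a} \<in> E \<or> {u, m} \<in> E"
      by (rule chordal_4_cycle[OF assms(1,2)]) (use assms neq 1 in \<open>auto simp: insert_commute\<close>)
    then show ?thesis using assms by blast
  qed
qed

lemma chordal_neighbourhood_cover:
  fixes E :: "'n::finite set set"
  assumes ch: "chordal E" and E: "simple_graph E" and U: "\<And>u. u \<in> U \<Longrightarrow> u \<noteq> i \<and> {i, u} \<notin> E"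
  obtains A where "A \<subseteq> U" "A \<inter> neighbours E A = {}"
    "\<And>l w. {i, l} \<in> E \<Longrightarrow> w \<in> U \<Longrightarrow> {l, w} \<in> E \<Longrightarrow> l \<in> neighbours E A"
proof (rule independent_cover[OF E, of "{l. {i, l} \<in> E}" U])
  fix l u a m assume "l \<in> {l. {i, l} \<in> E}" "u \<in> U" "a \<in> U" "m \<in> {l. {i, l} \<in> E}"
    "{l, u} \<in> E" "{u, a} \<in> E" "{a, m} \<in> E" "{l, a} \<notin> E"
  then show "{u, m} \<in> E" using chordal_exchange[OF ch E, of i l m u a] U by simp
next
  fix A assume A: "A \<subseteq> U" "A \<inter> neighbours E A = {}"
    "{l. {i, l} \<in> E} \<inter> neighbours E U \<subseteq> neighbours E A"
  show thesis
  proof (rule that[OF A(1,2)])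
    fix l w assume "{i, l} \<in> E" "w \<in> U" "{l, w} \<in> E"
    then have "l \<in> {l. {i, l} \<in> E} \<inter> neighbours E U"
      by (auto simp: neighbours_def insert_commute)
    then show "l \<in> neighbours E A" using A(3) by blast
  qed
qed

text \<open>Otherwise \<open>i\<close> would be adjacent to all other neighbours of
  \<open>l\<close>, of which there is at least one: the dominating obstruction centred at
  \<open>l\<close> with \<open>A\<close> empty.\<close>

lemma rigid_neighbour_not_dominated:
  fixes E :: "'n::finite set set"
  assumes E: "simple_graph E" and R: "rigid TYPE('k::field) E"
    and l: "{i, l} \<in> E" "\<not> pendant E l i"
  obtains w where "{l, w} \<in> E" "w \<noteq> i" "{i, w} \<notin> E"
proof (rule ccontr)
  assume *: "\<not> thesis"
  have li: "{l, i} \<in> E" using l(1) by (simp add: insert_commute)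
  then obtain q where q: "{l, q} \<in> E" "q \<noteq> i" using l(2) unfolding pendant_def by blast
  have "\<not> rigid TYPE('k) E"
    by (rule not_rigid_dominating_neighbour[OF E, of "{}" l i q])
      (use * that li q in \<open>auto simp: neighbours_def\<close>)
  then show False using R by blast
qed

text \<open>If \<open>i\<close> has no pendant neighbour, covering all of \<open>N(i)\<close> that can be covered from outside \<open>N(j)\<close> shows
  first that no neighbour of \<open>i\<close> dominates another one outside \<open>N[i]\<close>. Covering from outside
  \<open>N(j) \<union> N(k)\<close> then leaves \<open>j\<close>, \<open>k\<close> and only vertices adjacent to both.\<close>

lemma rigid_triangle_pendant:
  fixes E :: "'n::finite set set"
  assumes ch: "chordal E" and E: "simple_graph E" and R: "rigid TYPE('k::field) E"
    and ijk: "{i, j} \<in> E" "{i, k} \<in> E" "{j, k} \<in> E"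
  shows "\<exists>l. pendant E l i"
proof (rule ccontr)
  assume nop: "\<nexists>l. pendant E l i"
  have outer: "\<exists>w. {l, w} \<in> E \<and> w \<noteq> i \<and> {i, w} \<notin> E" if "{i, l} \<in> E" for l
    using rigid_neighbour_not_dominated[OF E R that] nop by blast
  have common: "{l, l'} \<in> E"
    if "{i, l} \<in> E" "{i, l'} \<in> E" "l \<noteq> l'" "{l, w} \<in> E" "{l', w} \<in> E" "w \<noteq> i" "{i, w} \<notin> E" for l l' w
  proof -
    have "{i, w} \<in> E \<or> {l, l'} \<in> E"
      by (rule chordal_4_cycle[OF ch E])
        (use that simple_graph_neq[OF E] in \<open>auto simp: insert_commute\<close>)
    then show ?thesis using that by blast
  qed
  \<comment> \<open>\<open>A\<close> is drawn from the vertices outside \<open>N[i]\<close> and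
    \<open>N(S)\<close>. A neighbour of \<open>i\<close> stays uncovered exactly when all its
    neighbours outside \<open>N[i]\<close> lie in \<open>N(S)\<close>.\<close>
  have cover: "\<exists>A. A \<inter> neighbours E A = {} \<and> i \<notin> A \<and> i \<notin> neighbours E A \<and> S \<inter> neighbours E A = {} \<and>
      (\<forall>l. {i, l} \<in> E \<and> l \<notin> neighbours E A \<longrightarrow>
        (\<forall>w. {l, w} \<in> E \<and> w \<noteq> i \<and> {i, w} \<notin> E \<longrightarrow> (\<exists>s\<in>S. {s, w} \<in> E))) \<and>
      (\<forall>l. (\<forall>w. {l, w} \<in> E \<and> w \<noteq> i \<and> {i, w} \<notin> E \<longrightarrow> (\<exists>s\<in>S. {s, w} \<in> E)) \<longrightarrow> l \<notin> neighbours E A)" for S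
  proof -
    let ?U = "{w. w \<noteq> i \<and> {i, w} \<notin> E \<and> (\<forall>s\<in>S. {s, w} \<notin> E)}"
    obtain A where A: "A \<subseteq> ?U" "A \<inter> neighbours E A = {}"
      "\<And>l w. {i, l} \<in> E \<Longrightarrow> w \<in> ?U \<Longrightarrow> {l, w} \<in> E \<Longrightarrow> l \<in> neighbours E A"
      by (rule chordal_neighbourhood_cover[OF ch E, of ?U i]) auto
    show ?thesis
    proof (intro exI[of _ A] conjI allI impI)
      show "i \<notin> A" "i \<notin> neighbours E A" "S \<inter> neighbours E A = {}"
        using A(1) neighbours_iff[of _ E A] by blast+
      show "\<exists>s\<in>S. {s, w} \<in> E"
        if "{i, l} \<in> E \<and> l \<notin> neighbours E A" "{l, w} \<in> E \<and> w \<noteq> i \<and> {i, w} \<notin> E" for l w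
        using that A(3)[of l w] by blast
      show "l \<notin> neighbours E A"
        if "\<forall>w. {l, w} \<in> E \<and> w \<noteq> i \<and> {i, w} \<notin> E \<longrightarrow> (\<exists>s\<in>S. {s, w} \<in> E)" for l
      proof
        assume "l \<in> neighbours E A"
        then obtain u where "u \<in> A" "{l, u} \<in> E" by (auto simp: neighbours_iff)
        then show False using that A(1) by blast
      qed
    qed (rule A(2))
  qed
  have undominated: "\<exists>w. {l, w} \<in> E \<and> w \<noteq> i \<and> {i, w} \<notin> E \<and> {j, w} \<notin> E"
    if jl: "{i, j} \<in> E" "{i, l} \<in> E" "l \<noteq> j" for j l
  proof (rule ccontr)
    assume no: "\<nexists>w. {l, w} \<in> E \<and> w \<noteq> i \<and> {i, w} \<notin> E \<and> {j, w} \<notin> E"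
    obtain A where A: "A \<inter> neighbours E A = {}" "i \<notin> A" "i \<notin> neighbours E A" "j \<notin> neighbours E A"
      "\<And>l w. {i, l} \<in> E \<Longrightarrow> l \<notin> neighbours E A \<Longrightarrow> {l, w} \<in> E \<Longrightarrow> w \<noteq> i \<Longrightarrow> {i, w} \<notin> E \<Longrightarrow> {j, w} \<in> E"
      "l \<notin> neighbours E A"
      using cover[of "{j}"] no by auto
    have "\<not> rigid TYPE('k) E"
    proof (rule not_rigid_dominating_neighbour[OF E A(1-3) jl(1) A(4) jl(2) A(6) jl(3)])
      fix m assume m: "{i, m} \<in> E" "m \<noteq> j" "m \<notin> neighbours E A"
      then obtain w where w: "{m, w} \<in> E" "w \<noteq> i" "{i, w} \<notin> E" using outer by blast
      then have "{j, w} \<in> E" using A(5) m by blast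
      then show "{j, m} \<in> E" using common[OF jl(1) m(1) m(2)[symmetric]] w by blast
    qed
    then show False using R by blast
  qed
  obtain A where A: "A \<inter> neighbours E A = {}" "i \<notin> A" "i \<notin> neighbours E A" "j \<notin> neighbours E A"
    "k \<notin> neighbours E A"
    "\<And>l w. {i, l} \<in> E \<Longrightarrow> l \<notin> neighbours E A \<Longrightarrow> {l, w} \<in> E \<Longrightarrow> w \<noteq> i \<Longrightarrow> {i, w} \<notin> E \<Longrightarrow>
      {j, w} \<in> E \<or> {k, w} \<in> E"
    using cover[of "{j, k}"] by auto
  have "\<not> rigid TYPE('k) E"
  proof (rule not_rigid_dominating_neighbour[OF E A(1-3) ijk(1) A(4) ijk(2) A(5)])
    show "k \<noteq> j" using simple_graph_neq[OF E ijk(3)] by blast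
    fix l assume l: "{i, l} \<in> E" "l \<noteq> j" "l \<notin> neighbours E A"
    show "{j, l} \<in> E"
    proof (cases "l = k")
      \<comment> \<open>By \<open>undominated\<close> with \<open>k\<close>, some \<open>w\<close>
        outside \<open>N[i]\<close> is adjacent to \<open>l\<close> but not to \<open>k\<close>. As
        \<open>l\<close> is uncovered, \<open>w\<close> is adjacent to \<open>j\<close>, and
        \<open>common\<close> joins \<open>j\<close> to \<open>l\<close>.\<close>
      case False
      obtain w where w: "{l, w} \<in> E" "w \<noteq> i" "{i, w} \<notin> E" "{k, w} \<notin> E"
        using undominated[OF ijk(2) l(1) False] by blast
      then have "{j, w} \<in> E" using A(6) l by blast
      then show ?thesis using common[OF ijk(1) l(1) l(2)[symmetric]] w by blast
    qed (use ijk(3) in simp)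
  qed
  then show False using R by blast
qed

text \<open>If \<open>j\<close> were the only pendant vertex at \<open>i\<close>, every other
  neighbour of \<open>i\<close> would have a neighbour outside \<open>N[i]\<close>; covering them
  all isolates the edge \<open>ij\<close>.\<close>

lemma rigid_pendant_triangle:
  fixes E :: "'n::finite set set"
  assumes ch: "chordal E" and E: "simple_graph E" and R: "rigid TYPE('k::field) E"
    and j: "pendant E j i"
  shows "\<exists>k. pendant E k i \<and> k \<noteq> j"
proof (rule ccontr)
  assume no: "\<nexists>k. pendant E k i \<and> k \<noteq> j"
  let ?U = "{w. w \<noteq> i \<and> {i, w} \<notin> E}"
  have ji: "{j, i} \<in> E" using j by (simp add: pendant_def)
  then have ij: "{i, j} \<in> E" by (simp add: insert_commute)
  obtain A where A: "A \<subseteq> ?U" "A \<inter> neighbours E A = {}"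
    "\<And>l w. {i, l} \<in> E \<Longrightarrow> w \<in> ?U \<Longrightarrow> {l, w} \<in> E \<Longrightarrow> l \<in> neighbours E A"
    by (rule chordal_neighbourhood_cover[OF ch E, of ?U i]) auto
  have "\<not> rigid TYPE('k) E"
  proof (rule not_rigid_isolated_edge[OF E A(2) ij])
    show "i \<notin> A" "j \<notin> A" using A(1) ij by auto
    show "k \<in> neighbours E A" if k: "{i, k} \<in> E" "k \<noteq> j" for k
    proof -
      obtain w where "{k, w} \<in> E" "w \<noteq> i" "{i, w} \<notin> E"
        using rigid_neighbour_not_dominated[OF E R k(1)] no k(2) by blast
      then show ?thesis using A(3)[OF k(1)] by blast
    qed
    show "k \<in> neighbours E A" if "{j, k} \<in> E" "k \<noteq> i" for k using j that by (simp add: pendant_def)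
  qed
  then show False using R by blast
qed

text \<open>Pendant vertices at a vertex never come singly, so a counterexample has none at
  \<open>i\<close> or \<open>j\<close>, and neither end lies in a triangle. An independent set
  outside \<open>N[i]\<close> and \<open>N[j]\<close> then covers all other neighbours of both ends
  and isolates \<open>ij\<close>.\<close>

lemma rigid_edge_pendant:
  fixes E :: "'n::finite set set"
  assumes ch: "chordal E" and E: "simple_graph E" and R: "rigid TYPE('k::field) E"
    and ij: "{i, j} \<in> E"
  shows "\<exists>k. pendant E k i \<and> k \<noteq> j \<or> pendant E k j \<and> k \<noteq> i"
proof (rule ccontr)
  assume no: "\<nexists>k. pendant E k i \<and> k \<noteq> j \<or> pendant E k j \<and> k \<noteq> i"
  then have "\<nexists>l. pendant E l i" "\<nexists>l. pendant E l j"
    using rigid_pendant_triangle[OF ch E R] by metis+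
  then have tri: "{p, q} \<notin> E" if "v \<in> {i, j}" "{v, p} \<in> E" "{v, q} \<in> E" for v p q
    using rigid_triangle_pendant[OF ch E R] that by blast
  have ji: "{j, i} \<in> E" using ij by (simp add: insert_commute)
  have neq: "i \<noteq> j" using simple_graph_neq[OF E ij] .
  let ?U = "{w. w \<notin> {i, j} \<and> {i, w} \<notin> E \<and> {j, w} \<notin> E}"
  let ?W = "{w. w \<notin> {i, j} \<and> ({i, w} \<in> E \<or> {j, w} \<in> E)}"
  \<comment> \<open>The exchange condition for \<open>l\<close> and \<open>m\<close> at opposite
    ends of \<open>ij\<close>: in the 6-cycle \<open>p l u a m q\<close> all chords but
    \<open>um\<close> are excluded, \<open>lm\<close> because the 4-cycle \<open>p l m q\<close>
    would have no chord.\<close>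
  have cross: "{u, m} \<in> E"
    if "{p, q} \<in> E" "{p, q} = {i, j}" "{p, l} \<in> E" "{q, m} \<in> E" "l \<notin> {i, j}" "m \<notin> {i, j}" "u \<in> ?U" "a \<in> ?U"
      "{l, u} \<in> E" "{u, a} \<in> E" "{a, m} \<in> E" "{l, a} \<notin> E" for p q l m u a
  proof -
    have pq: "p \<in> {i, j}" "q \<in> {i, j}" "{q, p} \<in> E" using that(1,2) by (auto simp: insert_commute)
    have U: "{p, u} \<notin> E" "{p, a} \<notin> E" "{q, u} \<notin> E" "{q, a} \<notin> E" "u \<notin> {p, q}" "a \<notin> {p, q}"
      using that(7,8) pq by auto
    have lq: "{q, l} \<notin> E" "{p, m} \<notin> E"
      using tri[OF pq(1) that(1,3)] tri[OF pq(2,3) that(4)] by (auto simp: insert_commute)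
    have d: "distinct [p, l, u, a, m, q]"
      using U lq that pq simple_graph_neq[OF E] by (auto simp: insert_commute)
    have "{p, u} \<in> E \<or> {p, a} \<in> E \<or> {p, m} \<in> E \<or> {l, a} \<in> E \<or> {l, m} \<in> E \<or> {l, q} \<in> E \<or>
        {u, m} \<in> E \<or> {u, q} \<in> E \<or> {a, q} \<in> E"
      by (rule chordal_6_cycle[OF ch E d]) (use that pq in \<open>auto simp: insert_commute\<close>)
    moreover have "{l, m} \<notin> E"
    proof
      assume "{l, m} \<in> E"
      then have "{p, m} \<in> E \<or> {l, q} \<in> E"
        by (intro chordal_4_cycle[OF ch E]) (use d that pq in \<open>auto simp: insert_commute\<close>)
      then show False using lq by (simp add: insert_commute)
    qed
    ultimately show ?thesis using U lq that(12) by (simp add: insert_commute)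
  qed
  obtain A where A: "A \<subseteq> ?U" "A \<inter> neighbours E A = {}" "?W \<inter> neighbours E ?U \<subseteq> neighbours E A"
  proof (rule independent_cover[OF E, of ?W ?U])
    fix l u a m assume *: "l \<in> ?W" "u \<in> ?U" "a \<in> ?U" "m \<in> ?W"
      "{l, u} \<in> E" "{u, a} \<in> E" "{a, m} \<in> E" "{l, a} \<notin> E"
    consider p where "p \<in> {i, j}" "{p, l} \<in> E" "{p, m} \<in> E"
      | "{i, l} \<in> E" "{j, m} \<in> E" | "{j, l} \<in> E" "{i, m} \<in> E"
      using *(1,4) by blast
    then show "{u, m} \<in> E"
    proof cases
      case 1
      show ?thesis
        by (rule chordal_exchange[OF ch E 1(2,3)]) (use * 1 in auto)
    next
      case 2
      then show ?thesis using cross[OF ij refl 2] * by blast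
    next
      case 3
      then show ?thesis using cross[OF ji insert_commute 3] * by blast
    qed
  qed blast
  \<comment> \<open>A second neighbour \<open>w\<close> of \<open>k\<close> is not adjacent to
    \<open>p\<close>, by the absence of triangles, nor to \<open>q\<close>, by the 4-cycle
    \<open>p k w q\<close>; so \<open>w\<close> can serve to cover \<open>k\<close>.\<close>
  have covered: "k \<in> neighbours E A"
    if pk: "{p, q} \<in> E" "{p, q} = {i, j}" "{p, k} \<in> E" "k \<noteq> q" "\<not> pendant E k p" for p q k
  proof -
    have pq: "p \<in> {i, j}" "q \<in> {i, j}" "{q, p} \<in> E" "p \<noteq> q"
      using pk(1,2) neq by (auto simp: insert_commute doubleton_eq_iff)
    have kp: "{k, p} \<in> E" "k \<noteq> p" using pk(3) simple_graph_neq[OF E pk(3)] by (auto simp: insert_commute)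
    then obtain w where w: "{k, w} \<in> E" "w \<noteq> p" using pk(5) unfolding pendant_def by blast
    have 1: "{p, w} \<notin> E" "{k, q} \<notin> E"
      using tri[OF pq(1) pk(3)] w(1) pk(1) by auto
    have 2: "{q, w} \<notin> E"
    proof
      assume "{q, w} \<in> E"
      then have "{p, w} \<in> E \<or> {k, q} \<in> E"
        by (intro chordal_4_cycle[OF ch E])
          (use pk w 1 pq kp simple_graph_neq[OF E] in \<open>auto simp: insert_commute\<close>)
      then show False using 1 by blast
    qed
    have "w \<noteq> q" using w(1) 1(2) by auto
    then have "w \<in> ?U" using 1 2 w(2) pk(2) by (auto simp: doubleton_eq_iff)
    moreover have "k \<in> ?W" using pk(2,3,4) kp(2) by (auto simp: doubleton_eq_iff)
    moreover have "{w, k} \<in> E" using w(1) by (simp add: insert_commute)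
    ultimately show ?thesis using A(3) unfolding neighbours_def by blast
  qed
  have "\<not> rigid TYPE('k) E"
  proof (rule not_rigid_isolated_edge[OF E A(2) ij])
    show "i \<notin> A" "j \<notin> A" using A(1) by auto
    show "k \<in> neighbours E A" if "{i, k} \<in> E" "k \<noteq> j" for k
      using covered[OF ij refl that] no that by blast
    show "k \<in> neighbours E A" if "{j, k} \<in> E" "k \<noteq> i" for k
      using covered[OF ji insert_commute that] no that by blast
  qed
  then show False using R by blast
qed

section \<open>Leaves and pendant vertices\<close>

lemma free_vertex_pendant:
  assumes "free_vertex E l" and "{l, x} \<in> E" and E: "simple_graph E"
  shows "pendant E l x"
proof -
  obtain e where e: "{e \<in> E. l \<in> e} = {e}"
    using assms(1) unfolding free_vertex_def vertex_degree_def by (rule card_1_singletonE)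
  have "v = x" if "{l, v} \<in> E" for v
  proof -
    have "{l, v} \<in> {e}" "{l, x} \<in> {e}" unfolding e[symmetric] using that assms(2) by simp_all
    then have "{l, v} = {l, x}" by simp
    then show ?thesis by (auto simp: doubleton_eq_iff)
  qed
  then show ?thesis unfolding pendant_def using assms(2) by blast
qed

lemma simple_graph_edgeE:
  assumes "simple_graph E" "e \<in> E" "x \<in> e"
  obtains z where "e = {x, z}" "x \<noteq> z"
proof -
  have "card e = 2" using assms by (simp add: simple_graph_def)
  then obtain a b where ab: "e = {a, b}" "a \<noteq> b" by (auto simp: card_2_iff)
  then consider "x = a" | "x = b" using assms(3) by blast
  then show ?thesis
    using that[of b] that[of a] ab by cases (auto simp: insert_commute)
qed

lemma pendant_leaf:
  assumes "pendant E l x" and E: "simple_graph E"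
  shows "leaf E {l, x}"
proof -
  have "{e \<in> E. l \<in> e} = {{l, x}}"
  proof (intro equalityI subsetI)
    fix e assume e: "e \<in> {e \<in> E. l \<in> e}"
    then obtain v where "e = {l, v}" using simple_graph_edgeE[OF E] by blast
    then show "e \<in> {{l, x}}" using e assms(1) by (auto simp: pendant_def)
  qed (use assms(1) in \<open>auto simp: pendant_def\<close>)
  then show ?thesis
    unfolding leaf_def free_vertex_def vertex_degree_def using assms(1) by (auto simp: pendant_def)
qed

text \<open>The second edge \<open>f\<close> at \<open>x\<close> shows that \<open>x\<close> is not
  free, so the free vertex of the leaf is its other end.\<close>

lemma leaf_pendant:
  assumes E: "simple_graph E" and e: "leaf E e" "x \<in> e" and f: "f \<in> E" "x \<in> f" "f \<noteq> e"
  obtains z where "e = {x, z}" "pendant E z x"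
proof -
  have eE: "e \<in> E" using e(1) by (simp add: leaf_def)
  obtain z where z: "e = {x, z}" "x \<noteq> z"
    using simple_graph_edgeE[OF E eE e(2)] .
  obtain y where y: "f = {x, y}" 
    using simple_graph_edgeE[OF E f(1,2)] .
  have "\<not> free_vertex E x"
    using free_vertex_pendant[OF _ _ E, of x z] eE f unfolding z y pendant_def by auto
  then have "free_vertex E z" using e(1) unfolding leaf_def z by blast
  then have "pendant E z x" by (rule free_vertex_pendant[OF _ _ E]) (use eE z in \<open>simp add: insert_commute\<close>)
  then show ?thesis using that z by blast
qed

theorem corollary3p11:
  fixes E :: "'n::finite set set"
  assumes "simple_graph E" and "chordal E"
  shows "rigid TYPE('k::field) E \<longleftrightarrow>
    (\<forall>e\<in>E. branch E e) \<and>
    (\<forall>c. is_cycle E c \<and> length c = 3 \<longrightarrow> (\<forall>v\<in>set c. \<exists>e. leaf E e \<and> v \<in> e))"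
proof
  note E = assms(1)
  assume R: "rigid TYPE('k) E"
  show "(\<forall>e\<in>E. branch E e) \<and>
    (\<forall>c. is_cycle E c \<and> length c = 3 \<longrightarrow> (\<forall>v\<in>set c. \<exists>e. leaf E e \<and> v \<in> e))"
  proof (intro conjI ballI allI impI)
    fix e assume e: "e \<in> E"
    then obtain i j where ij: "e = {i, j}" using E unfolding simple_graph_def by (metis card_2_iff)
    then obtain k x y where k: "pendant E k x" "k \<noteq> y" "e = {x, y}"
      using rigid_edge_pendant[OF assms(2,1) R, of i j] e by (metis insert_commute)
    have "k \<noteq> x" using k(1) simple_graph_neq[OF E, of k x] by (simp add: pendant_def)
    then have "{k, x} \<noteq> e" using k by (auto simp: doubleton_eq_iff)
    then show "branch E e"
      unfolding branch_def using pendant_leaf[OF k(1) E] e k(3) by blast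
  next
    fix c v assume c: "is_cycle E c \<and> length c = 3" and v: "v \<in> set c"
    then obtain x y z where "c = [x, y, z]" by (auto simp: numeral_3_eq_3 length_Suc_conv)
    then have "{x, y} \<in> E" "{y, z} \<in> E" "{z, x} \<in> E" "v \<in> {x, y, z}"
      using c v unfolding is_cycle_def by (auto simp: cycle_edges_simps)
    then obtain p q where "{v, p} \<in> E" "{v, q} \<in> E" "{p, q} \<in> E"
      by (metis (no_types, lifting) insert_commute insertE singletonD)
    then obtain l where "pendant E l v" using rigid_triangle_pendant[OF assms(2,1) R] by blast
    then show "\<exists>e. leaf E e \<and> v \<in> e" using pendant_leaf[OF _ E] by blast
  qed
next
  note E = assms(1)
  assume R: "(\<forall>e\<in>E. branch E e) \<and>
    (\<forall>c. is_cycle E c \<and> length c = 3 \<longrightarrow> (\<forall>v\<in>set c. \<exists>e. leaf E e \<and> v \<in> e))"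
  show "rigid TYPE('k) E"
  proof (rule rigid_if_pendants[OF E])
    fix i j assume ij: "{i, j} \<in> E"
    then obtain e where e: "leaf E e" "e \<noteq> {i, j}" "{i, j} \<inter> e \<noteq> {}"
      using R unfolding branch_def by metis
    then obtain x where x: "x \<in> {i, j}" "x \<in> e" by blast
    \<comment> \<open>The edge \<open>ij\<close> itself is the second edge at
      \<open>x\<close>.\<close>
    obtain z where "e = {x, z}" "pendant E z x"
      using leaf_pendant[OF E e(1) x(2) ij x(1)] e(2) by metis
    then show "\<exists>k. pendant E k i \<and> k \<noteq> j \<or> pendant E k j \<and> k \<noteq> i"
      using x(1) e(2) by (auto simp: insert_commute)
  next
    fix i j k assume ijk: "{i, j} \<in> E" "{i, k} \<in> E" "{j, k} \<in> E"
    have neq: "i \<noteq> j" "i \<noteq> k" "j \<noteq> k" using ijk simple_graph_neq[OF E] by auto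
    have "is_cycle E [i, j, k]"
      using ijk neq unfolding is_cycle_def cycle_edges_simps by (auto simp: insert_commute)
    then obtain e where e: "leaf E e" "i \<in> e" using R by fastforce
    \<comment> \<open>Of the two triangle edges at \<open>i\<close>, at least one differs from the
      leaf \<open>e\<close>.\<close>
    have "{i, j} \<noteq> {i, k}" using neq by (auto simp: doubleton_eq_iff)
    then obtain f where "f \<in> E" "i \<in> f" "f \<noteq> e" using ijk by blast
    then show "\<exists>l. pendant E l i" using leaf_pendant[OF E e] by metis
  qed
qed

end
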